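(* Let $n\ge1$ and let $(M,\omega)$ be a pre-$n$-plectic manifold. There is a Lie $n$-algebra $\mathrm{Ham}_\infty(M,\omega)$ with underlying graded vector space $$L^0=\{(v,\alpha)\in\mathfrak X_{\mathrm{Ham}}(M)\oplus\Omega^{n-1}_{\mathrm{Ham}}(M)\ :\ d\alpha=-\iota_v\omega\},\qquad L^i=\Omega^{n-1+i}(M)\ \ (1-n\le i<0),$$ and structure maps $$\tilde l_1(\alpha)=\begin{cases}(0,d\alpha)&\text{if }|\alpha|=-1,\\ d\alpha&\text{if }|\alpha|<-1,\end{cases}$$ $$\tilde l_2(x_1,x_2)=\begin{cases}\bigl([v_1,v_2],\iota(v_1\wedge v_2)\omega\bigr)&\text{if }|x_1\otimes x_2|=0,\\0&\text{otherwise},\end{cases}$$ and for $k>2$ $$\tilde l_k(x_1,\ldots,x_k)=\begin{cases}\varsigma(k)\,\iota(v_1\wedge\cdots\wedge v_k)\omega&\text{if }|x_1\otimes\cdots\otimes x_k|=0,\\0&\text{otherwise},\end{cases}$$ where $x_i=(v_i,\alpha_i)$ for elements of degree $0$.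
   Context: A pre-$n$-plectic manifold $(M,\omega)$ is a manifold with a closed $(n+1)$-form $\omega$. A vector field $v$ is Hamiltonian if there is an $(n-1)$-form $\alpha$ with $d\alpha=-\iota_v\omega$ (then $\alpha$ is called Hamiltonian); $\mathfrak X_{\mathrm{Ham}}(M)$ and $\Omega^{n-1}_{\mathrm{Ham}}(M)$ are the spaces of Hamiltonian vector fields and Hamiltonian $(n-1)$-forms. $\iota(v_1\wedge\cdots\wedge v_k)=\iota_{v_k}\cdots\iota_{v_1}$ and $\varsigma(k)=-(-1)^{k(k+1)/2}$. The degree of $x_1\otimes\cdots\otimes x_k$ is $\sum_i|x_i|$. An $L_\infty$-algebra is a graded vector space $L$ with graded skew-symmetric linear maps $l_k:L^{\otimes k}\to L$ of degree $2-k$, $k\ge1$, such that for all $m\ge1$ $$\sum_{i+j=m+1,\ \sigma\in\mathrm{Sh}(i,m-i)}(-1)^\sigma\epsilon(\sigma)(-1)^{i(j-1)}l_j(l_i(x_{\sigma(1)},\ldots,x_{\sigma(i)}),x_{\sigma(i+1)},\ldots,x_{\sigma(m)})=0,$$ where $\mathrm{Sh}(i,m-i)$ is the set of permutations with $\sigma(a)<\sigma(a+1)$ for $a\ne i$, $(-1)^\sigma$ is the sign of $\sigma$, and $\epsilon(\sigma)$ is the Koszul sign (not including $(-1)^\sigma$) defined by $x_1\cdots x_m=\epsilon(\sigma)x_{\sigma(1)}\cdots x_{\sigma(m)}$ in the free graded commutative algebra. Skew-symmetric means $f(x_{\sigma(1)},\ldots,x_{\sigma(m)})=(-1)^\sigma\epsilon(\sigma)f(x_1,\ldots,x_m)$.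 A Lie $n$-algebra is an $L_\infty$-algebra concentrated in degrees $0,-1,\ldots,1-n$. *)

theory Defs
  imports
    "HOL-Analysis.Analysis"
    "HOL-Library.Function_Algebras"
    "HOL-Combinatorics.Permutations"
begin

section \<open>Pointwise real vector space structure on functions\<close>

instantiation "fun" :: (type, real_vector) real_vector
begin

definition scaleR_fun :: "real \<Rightarrow> ('a \<Rightarrow> 'b) \<Rightarrow> 'a \<Rightarrow> 'b"
  where "scaleR_fun c f = (\<lambda>x. c *\<^sub>R f x)"

instance
  by standard
    (simp_all add: scaleR_fun_def plus_fun_def fun_eq_iff scaleR_add_right scaleR_add_left)

end


section \<open>Smooth manifolds\<close>

primrec Ck_on :: "nat \<Rightarrow> 'b::real_normed_vector set \<Rightarrow> ('b \<Rightarrow> 'c::real_normed_vector) \<Rightarrow> bool"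
  where
    "Ck_on 0 S f \<longleftrightarrow> continuous_on S f"
  | "Ck_on (Suc k) S f \<longleftrightarrow>
       (\<forall>x\<in>S. f differentiable (at x)) \<and>
       (\<forall>v. Ck_on k S (\<lambda>x. frechet_derivative f (at x) v))"

text \<open>Only used for open subsets of finite-dimensional spaces, where continuity of all iterated
  directional derivatives is the usual notion of smoothness.\<close>

definition smooth_on :: "'b::real_normed_vector set \<Rightarrow> ('b \<Rightarrow> 'c::real_normed_vector) \<Rightarrow> bool"
  where "smooth_on S f \<longleftrightarrow> (\<forall>k. Ck_on k S f)"

text \<open>A chart is a pair of its domain and its coordinate map; the values of the map outside of
  the domain are irrelevant.\<close>

record ('a, 'b) atlas_space =
  top_of :: "'a topology"
  charts :: "('a set \<times> ('a \<Rightarrow> 'b)) set"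

abbreviation points :: "('a, 'b) atlas_space \<Rightarrow> 'a set"
  where "points M \<equiv> topspace (top_of M)"

text \<open>The model space \<^typ>\<open>'b\<close> is a finite-dimensional normed space rather than a
  \<^class>\<open>euclidean_space\<close>, because the latter excludes dimension zero.\<close>

definition smooth_manifold :: "('a, 'b::real_normed_vector) atlas_space \<Rightarrow> bool"
  where "smooth_manifold M \<longleftrightarrow>
    (\<exists>B::'b set. finite B \<and> span B = UNIV) \<and>
    Hausdorff_space (top_of M) \<and> second_countable (top_of M) \<and>
    (\<Union>(U, \<phi>)\<in>charts M. U) = points M \<and>
    (\<forall>(U, \<phi>)\<in>charts M. openin (top_of M) U \<and> open (\<phi> ` U) \<and>
       homeomorphic_map (subtopology (top_of M) U) (top_of_set (\<phi> ` U)) \<phi>) \<and>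
    (\<forall>(U, \<phi>)\<in>charts M. \<forall>(V, \<psi>)\<in>charts M.
       smooth_on (\<phi> ` (U \<inter> V)) (\<lambda>y. \<psi> (inv_into U \<phi> y)))"

text \<open>Functions, tangent vectors, vector fields and forms are all extended by zero outside of
  their actual domain, so that each of these spaces is a linear subspace of a function type.\<close>

definition smooth_functions :: "('a, 'b::real_normed_vector) atlas_space \<Rightarrow> ('a \<Rightarrow> real) set"
  where "smooth_functions M = {f.
    (\<forall>p. p \<notin> points M \<longrightarrow> f p = 0) \<and>
    (\<forall>(U, \<phi>)\<in>charts M. smooth_on (\<phi> ` U) (\<lambda>y. f (inv_into U \<phi> y)))}"


section \<open>Vector fields\<close>

text \<open>A tangent vector at \<open>p\<close> is a derivation at \<open>p\<close> of the algebra of smooth functions.\<close>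

definition tangent_space ::
    "('a, 'b::real_normed_vector) atlas_space \<Rightarrow> 'a \<Rightarrow> (('a \<Rightarrow> real) \<Rightarrow> real) set"
  where "tangent_space M p = {v.
    (\<forall>f\<in>smooth_functions M. \<forall>g\<in>smooth_functions M.
       v (f + g) = v f + v g \<and> v (f * g) = f p * v g + g p * v f) \<and>
    (\<forall>c. \<forall>f\<in>smooth_functions M. v (c *\<^sub>R f) = c * v f) \<and>
    (\<forall>f. f \<notin> smooth_functions M \<longrightarrow> v f = 0)}"

type_synonym 'a vfield = "'a \<Rightarrow> ('a \<Rightarrow> real) \<Rightarrow> real"

definition act :: "'a vfield \<Rightarrow> ('a \<Rightarrow> real) \<Rightarrow> 'a \<Rightarrow> real"
  where "act X f = (\<lambda>p. X p f)"

definition vector_fields :: "('a, 'b::real_normed_vector) atlas_space \<Rightarrow> 'a vfield set"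
  where "vector_fields M = {X.
    (\<forall>p\<in>points M. X p \<in> tangent_space M p) \<and>
    (\<forall>p. p \<notin> points M \<longrightarrow> X p = 0) \<and>
    (\<forall>f\<in>smooth_functions M. act X f \<in> smooth_functions M)}"

definition fmult :: "('a \<Rightarrow> real) \<Rightarrow> 'a vfield \<Rightarrow> 'a vfield"
  where "fmult f X = (\<lambda>p. f p *\<^sub>R X p)"

definition lie_bracket :: "'a vfield \<Rightarrow> 'a vfield \<Rightarrow> 'a vfield"
  where "lie_bracket X Y = (\<lambda>p f. X p (act Y f) - Y p (act X f))"


section \<open>Differential forms\<close>

text \<open>A \<open>k\<close>-form is an alternating map on \<open>k\<close>-tuples of vector fields that is multilinear over
  the ring of smooth functions and takes values in that ring (on a second countable Hausdorff
  manifold these are exactly the smooth sections of \<open>\<Lambda>\<^sup>kT\<^sup>*M\<close>). A \<open>0\<close>-form \<open>\<omega>\<close> is the smooth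
  function \<open>\<omega> []\<close>.\<close>

type_synonym 'a form = "'a vfield list \<Rightarrow> 'a \<Rightarrow> real"

definition forms :: "('a, 'b::real_normed_vector) atlas_space \<Rightarrow> nat \<Rightarrow> 'a form set"
  where "forms M k = {\<omega>.
    (\<forall>Xs. \<not> (length Xs = k \<and> set Xs \<subseteq> vector_fields M) \<longrightarrow> \<omega> Xs = 0) \<and>
    (\<forall>Xs. length Xs = k \<and> set Xs \<subseteq> vector_fields M \<longrightarrow>
       \<omega> Xs \<in> smooth_functions M \<and>
       (\<forall>i<k. \<forall>X\<in>vector_fields M. \<forall>Y\<in>vector_fields M.
          \<omega> (Xs[i := X + Y]) = \<omega> (Xs[i := X]) + \<omega> (Xs[i := Y])) \<and>
       (\<forall>i<k. \<forall>f\<in>smooth_functions M. \<forall>X\<in>vector_fields M.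
          \<omega> (Xs[i := fmult f X]) = f * \<omega> (Xs[i := X])) \<and>
       (\<forall>i j. i < j \<and> j < k \<and> Xs ! i = Xs ! j \<longrightarrow> \<omega> Xs = 0))}"

text \<open>The exterior derivative, given by the invariant formula
  \[ d\omega(X_0,\dots,X_k) = \sum_i (-1)^i X_i\,\omega(\dots,\hat X_i,\dots)
     + \sum_{i<j} (-1)^{i+j} \omega([X_i,X_j],\dots,\hat X_i,\dots,\hat X_j,\dots). \]\<close>

definition ext_deriv :: "('a, 'b::real_normed_vector) atlas_space \<Rightarrow> 'a form \<Rightarrow> 'a form"
  where "ext_deriv M \<omega> = (\<lambda>Xs.
    if set Xs \<subseteq> vector_fields M then
      (\<Sum>i<length Xs. (-1) ^ i *\<^sub>R act (Xs ! i) (\<omega> (nths Xs (- {i})))) +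
      (\<Sum>(i, j)\<in>{(i, j). i < j \<and> j < length Xs}.
         (-1) ^ (i + j) *\<^sub>R \<omega> (lie_bracket (Xs ! i) (Xs ! j) # nths Xs (- {i, j})))
    else 0)"

definition interior :: "'a vfield \<Rightarrow> 'a form \<Rightarrow> 'a form"
  where "interior v \<omega> = (\<lambda>Xs. \<omega> (v # Xs))"

text \<open>\<open>contract [v\<^sub>1, \<dots>, v\<^sub>k] \<omega>\<close> is \<open>\<iota>(v\<^sub>1 \<and> \<dots> \<and> v\<^sub>k) \<omega>\<close>: the vector field \<open>v\<^sub>1\<close> is contracted
  first, and \<open>v\<^sub>k\<close> last.\<close>

definition contract :: "'a vfield list \<Rightarrow> 'a form \<Rightarrow> 'a form"
  where "contract vs \<omega> = fold interior vs \<omega>"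


section \<open>\<open>L\<^sub>\<infinity>\<close>-algebras\<close>

text \<open>A graded vector space is a family of subspaces \<open>L i\<close> of an ambient real vector space; no
  independence of these subspaces is required, since elements carry their degree explicitly.
  Multilinear maps on the \<open>k\<close>-th tensor power are given by their values on lists of \<open>k\<close>
  homogeneous elements, each a pair \<open>(degree, vector)\<close>; values on other lists are irrelevant.\<close>

definition homogeneous :: "(int \<Rightarrow> 'v set) \<Rightarrow> (int \<times> 'v) list \<Rightarrow> bool"
  where "homogeneous L xs \<longleftrightarrow> (\<forall>(p, x)\<in>set xs. x \<in> L p)"

definition degree_of :: "(int \<times> 'v) list \<Rightarrow> int"
  where "degree_of xs = sum_list (map fst xs)"

definition graded_multilinear ::
    "(int \<Rightarrow> 'v::real_vector set) \<Rightarrow> nat \<Rightarrow> int \<Rightarrow> ((int \<times> 'v) list \<Rightarrow> 'v) \<Rightarrow> bool"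
  where "graded_multilinear L k d f \<longleftrightarrow>
    (\<forall>xs. length xs = k \<and> homogeneous L xs \<longrightarrow>
       f xs \<in> L (degree_of xs + d) \<and>
       (\<forall>i<k. \<forall>p. \<forall>u\<in>L p. \<forall>v\<in>L p.
          f (xs[i := (p, u + v)]) = f (xs[i := (p, u)]) + f (xs[i := (p, v)])) \<and>
       (\<forall>i<k. \<forall>p. \<forall>c. \<forall>u\<in>L p.
          f (xs[i := (p, c *\<^sub>R u)]) = c *\<^sub>R f (xs[i := (p, u)])))"

text \<open>Sorting \<open>x\<^bsub>\<sigma>(1)\<^esub> \<dots> x\<^bsub>\<sigma>(m)\<^esub>\<close> into \<open>x\<^sub>1 \<dots> x\<^sub>m\<close> in the free graded commutative algebra interchanges
  exactly the pairs inverted by \<open>\<sigma>\<close>, each contributing \<open>(-1)\<^sup>|\<^sup>x\<^sup>|\<^sup>|\<^sup>y\<^sup>|\<close>. Indices start at zero.\<close>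

definition koszul_sign :: "(nat \<Rightarrow> nat) \<Rightarrow> (int \<times> 'v) list \<Rightarrow> int"
  where "koszul_sign \<sigma> xs =
    (\<Prod>(a, b)\<in>{(a, b). a < b \<and> b < length xs \<and> \<sigma> b < \<sigma> a}.
       if odd (fst (xs ! \<sigma> a) * fst (xs ! \<sigma> b)) then -1 else 1)"

definition graded_skew ::
    "(int \<Rightarrow> 'v::real_vector set) \<Rightarrow> nat \<Rightarrow> ((int \<times> 'v) list \<Rightarrow> 'v) \<Rightarrow> bool"
  where "graded_skew L k f \<longleftrightarrow>
    (\<forall>xs \<sigma>. length xs = k \<and> homogeneous L xs \<and> \<sigma> permutes {..<k} \<longrightarrow>
       f (permute_list \<sigma> xs) = of_int (sign \<sigma> * koszul_sign \<sigma> xs) *\<^sub>R f xs)"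

definition shuffles_of :: "nat \<Rightarrow> nat \<Rightarrow> (nat \<Rightarrow> nat) set"
  where "shuffles_of i m =
    {\<sigma>. \<sigma> permutes {..<m} \<and> (\<forall>a. Suc a < m \<and> Suc a \<noteq> i \<longrightarrow> \<sigma> a < \<sigma> (Suc a))}"

definition jacobiator :: "(nat \<Rightarrow> (int \<times> 'v::real_vector) list \<Rightarrow> 'v) \<Rightarrow> (int \<times> 'v) list \<Rightarrow> 'v"
  where "jacobiator l xs = (let m = length xs in
    \<Sum>(i, j)\<in>{(i, j). 1 \<le> i \<and> 1 \<le> j \<and> i + j = m + 1}. \<Sum>\<sigma>\<in>shuffles_of i m.
      (let ys = take i (permute_list \<sigma> xs); zs = drop i (permute_list \<sigma> xs) in
       of_int (sign \<sigma> * koszul_sign \<sigma> xs * (-1) ^ (i * (j - 1))) *\<^sub>R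
         l j ((degree_of ys + 2 - int i, l i ys) # zs)))"

definition L_infinity_algebra ::
    "(int \<Rightarrow> 'v::real_vector set) \<Rightarrow> (nat \<Rightarrow> (int \<times> 'v) list \<Rightarrow> 'v) \<Rightarrow> bool"
  where "L_infinity_algebra L l \<longleftrightarrow>
    (\<forall>i. subspace (L i)) \<and>
    (\<forall>k\<ge>1. graded_multilinear L k (2 - int k) (l k) \<and> graded_skew L k (l k)) \<and>
    (\<forall>xs. length xs \<ge> 1 \<and> homogeneous L xs \<longrightarrow> jacobiator l xs = 0)"

definition Lie_n_algebra ::
    "nat \<Rightarrow> (int \<Rightarrow> 'v::real_vector set) \<Rightarrow> (nat \<Rightarrow> (int \<times> 'v) list \<Rightarrow> 'v) \<Rightarrow> bool"
  where "Lie_n_algebra n L l \<longleftrightarrow>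
    L_infinity_algebra L l \<and> (\<forall>i. i \<notin> {1 - int n..0} \<longrightarrow> L i = {0})"


section \<open>Pre-\<open>n\<close>-plectic manifolds and \<open>Ham\<^sub>\<infinity>(M, \<omega>)\<close>\<close>

definition pre_n_plectic ::
    "nat \<Rightarrow> ('a, 'b::real_normed_vector) atlas_space \<Rightarrow> 'a form \<Rightarrow> bool"
  where "pre_n_plectic n M \<omega> \<longleftrightarrow>
    smooth_manifold M \<and> \<omega> \<in> forms M (n + 1) \<and> ext_deriv M \<omega> = 0"

definition ham_vector_fields ::
    "nat \<Rightarrow> ('a, 'b::real_normed_vector) atlas_space \<Rightarrow> 'a form \<Rightarrow> 'a vfield set"
  where "ham_vector_fields n M \<omega> =
    {v \<in> vector_fields M. \<exists>\<alpha>\<in>forms M (n - 1). ext_deriv M \<alpha> = - interior v \<omega>}"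

definition ham_forms ::
    "nat \<Rightarrow> ('a, 'b::real_normed_vector) atlas_space \<Rightarrow> 'a form \<Rightarrow> 'a form set"
  where "ham_forms n M \<omega> =
    {\<alpha> \<in> forms M (n - 1). \<exists>v\<in>vector_fields M. ext_deriv M \<alpha> = - interior v \<omega>}"

text \<open>In order for all degrees to share one ambient type, a form \<open>\<alpha>\<close> of negative degree is
  represented by the pair \<open>(0, \<alpha>)\<close>.\<close>

definition Ham_space ::
    "nat \<Rightarrow> ('a, 'b::real_normed_vector) atlas_space \<Rightarrow> 'a form \<Rightarrow>
      int \<Rightarrow> ('a vfield \<times> 'a form) set"
  where "Ham_space n M \<omega> i =
    (if i = 0 then
       {(v, \<alpha>). v \<in> ham_vector_fields n M \<omega> \<and> \<alpha> \<in> ham_forms n M \<omega> \<and>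
                ext_deriv M \<alpha> = - interior v \<omega>}
     else if 1 - int n \<le> i \<and> i < 0 then {(0, \<alpha>) | \<alpha>. \<alpha> \<in> forms M (nat (int n - 1 + i))}
     else {0})"

definition varsigma :: "nat \<Rightarrow> real"
  where "varsigma k = - ((-1) ^ (k * (k + 1) div 2))"

text \<open>With the above representation of forms, both cases of \<open>l\<^sub>1\<close> become \<open>(0, d\<alpha>)\<close>. On degree
  \<open>0\<close>, \<open>l\<^sub>1\<close> takes values in \<open>L\<^sup>1 = 0\<close>.\<close>

definition Ham_bracket ::
    "('a, 'b::real_normed_vector) atlas_space \<Rightarrow> 'a form \<Rightarrow>
      nat \<Rightarrow> (int \<times> 'a vfield \<times> 'a form) list \<Rightarrow> 'a vfield \<times> 'a form"
  where "Ham_bracket M \<omega> k xs = (let v = (\<lambda>i. fst (snd (xs ! i))); \<alpha> = (\<lambda>i. snd (snd (xs ! i))) in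
    if k = 1 then
      (if degree_of xs < 0 then (0, ext_deriv M (\<alpha> 0)) else 0)
    else if degree_of xs \<noteq> 0 then 0
    else if k = 2 then (lie_bracket (v 0) (v 1), contract [v 0, v 1] \<omega>)
    else (0, varsigma k *\<^sub>R contract (map v [0..<k]) \<omega>))"

end

theory Submission
  imports Defs
begin

text \<open>The theorem is a statement about Cartan calculus over a Lie algebra of derivations: smooth
functions form an algebra, by the product rule, and a vector field is the same thing as a
derivation of this algebra (\<open>vector_fields_iff\<close>).

The exterior derivative is given by its invariant formula, from which \<open>d\<^sup>2 = 0\<close>, or even that
\<open>d\<omega>\<close> is linear over functions, is awkward to read off. All of it follows by induction on the
degree from the single identity \<open>\<iota>\<^sub>X d = L\<^sub>X - d \<iota>\<^sub>X\<close> (\<open>interior_ext_deriv\<close>), because a form of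
positive degree is determined by its interior products, which have lower degree
(\<open>forms_SucI\<close>, \<open>form_ext\<close>). The identities \<open>[L\<^sub>X, \<iota>\<^sub>Y] = \<iota>\<^bsub>[X,Y]\<^esub>\<close>, \<open>[L\<^sub>X, L\<^sub>Y] = L\<^bsub>[X,Y]\<^esub>\<close>,
\<open>[d, L\<^sub>X] = 0\<close> and \<open>d\<^sup>2 = 0\<close> come out in this order.

If \<open>\<omega>\<close> is closed and \<open>d \<iota>\<^bsub>v\<^esub>\<omega> = 0\<close> for each of \<open>v\<^sub>1, \<dots>, v\<^sub>m\<close>, then every \<open>L\<^bsub>v\<^esub>\<close> kills \<open>\<omega>\<close>, and
induction on \<open>m\<close> yields the central formula (\<open>ext_deriv_contract\<close>)
\[ d\,\iota(v_1\wedge\dots\wedge v_m)\omega = (-1)^m \sum_{i<j} (-1)^{i+j}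
   \iota([v_i,v_j]\wedge v_1\wedge\dots\hat v_i\dots\hat v_j\dots\wedge v_m)\omega. \]
For \<open>m = 2\<close> it says that the bracket of two Hamiltonian vector fields is Hamiltonian.

In the generalised Jacobi identity nearly all summands vanish one by one: a bracket of at
least two arguments involves only the vector fields of its arguments, and these are zero
except in degree \<open>0\<close> (\<open>Ham_bracket_composite_zero\<close>). For one argument the identity is
\<open>d\<^sup>2 = 0\<close>. For \<open>m \<ge> 3\<close> arguments, all of degree \<open>0\<close>, what survives is the sum of all
\<open>l\<^bsub>m-1\<^esub>([x\<^sub>i, x\<^sub>j], \<dots>)\<close> over \<open>(2, m - 2)\<close>-shuffles, that is over pairs \<open>i < j\<close>, plus the single term
\<open>l\<^sub>1(l\<^sub>m(x\<^sub>1, \<dots>, x\<^sub>m))\<close>. In the form component they cancel by the central formula, the signs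
\<open>\<varsigma>\<close> being made for this (\<open>varsigma_Suc\<close>); the vector field component is only present for
\<open>m = 3\<close> and is the Jacobi identity.\<close>

section \<open>The algebra of smooth functions\<close>

text \<open>Derivatives are only controlled on an open set, since the coordinate representation of a
function has arbitrary values outside the image of the chart.\<close>

lemma frechet_derivative_cong_open:
  assumes "open S" "x \<in> S" "\<And>y. y \<in> S \<Longrightarrow> f y = g y"
  shows "frechet_derivative f (at x) = frechet_derivative g (at x)"
    and "f differentiable (at x) \<longleftrightarrow> g differentiable (at x)"
proof -
  have "(f has_derivative D) (at x) \<longleftrightarrow> (g has_derivative D) (at x)" for D
    using has_derivative_transform_within_open[of f D x UNIV S g]
      has_derivative_transform_within_open[of g D x UNIV S f] assms by auto
  then show "frechet_derivative f (at x) = frechet_derivative g (at x)"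
    "f differentiable (at x) \<longleftrightarrow> g differentiable (at x)"
    by (simp_all add: frechet_derivative_def differentiable_def)
qed

lemma Ck_on_cong:
  assumes "open S" "\<And>x. x \<in> S \<Longrightarrow> f x = g x"
  shows "Ck_on k S f \<longleftrightarrow> Ck_on k S g"
  using assms(2)
proof (induction k arbitrary: f g)
  case 0
  then show ?case by (simp cong: continuous_on_cong)
next
  case (Suc k)
  show ?case
    unfolding Ck_on.simps
  proof (intro arg_cong2[of _ _ _ _ "(\<and>)"] ball_cong all_cong1 refl)
    fix x assume "x \<in> S"
    then show "f differentiable (at x) \<longleftrightarrow> g differentiable (at x)"
      by (rule frechet_derivative_cong_open(2)[OF assms(1)]) (rule Suc.prems)
  next
    fix v
    show "Ck_on k S (\<lambda>x. frechet_derivative f (at x) v) \<longleftrightarrow>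
      Ck_on k S (\<lambda>x. frechet_derivative g (at x) v)"
      by (rule Suc.IH, rule fun_cong, rule frechet_derivative_cong_open(1)[OF assms(1)])
        (assumption, rule Suc.prems)
  qed
qed

text \<open>The derivative of a product contains the factors themselves besides their derivatives, so the
induction for products needs that factors of class \<open>C\<^bsup>k+1\<^esup>\<close> are also of class \<open>C\<^sup>k\<close>.\<close>

lemma Ck_on_decrease: "Ck_on (Suc k) S f \<Longrightarrow> Ck_on k S f"
proof (induction k arbitrary: f)
  case 0
  then show ?case
    by (auto intro!: continuous_at_imp_continuous_on differentiable_imp_continuous_within)
next
  case (Suc k)
  from Suc.prems have "f differentiable (at x)" if "x \<in> S" for x
    using that by (auto simp only: Ck_on.simps(2))
  moreover from Suc.prems have "Ck_on k S (\<lambda>x. frechet_derivative f (at x) v)" for v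
    using Suc.prems unfolding Ck_on.simps(2)[of "Suc k"] by (blast intro: Suc.IH)
  ultimately show ?case by simp
qed

lemma Ck_on_const: "Ck_on k S (\<lambda>x. c)"
  by (induction k arbitrary: c) (simp_all add: frechet_derivative_const)

lemma Ck_on_add:
  assumes "open S" "Ck_on k S f" "Ck_on k S g"
  shows "Ck_on k S (\<lambda>x. f x + g x)"
  using assms(2,3)
proof (induction k arbitrary: f g)
  case 0
  then show ?case by (simp add: continuous_on_add)
next
  case (Suc k)
  have eq: "frechet_derivative (\<lambda>x. f x + g x) (at x) v =
      frechet_derivative f (at x) v + frechet_derivative g (at x) v" if "x \<in> S" for x v
  proof -
    have "(f has_derivative frechet_derivative f (at x)) (at x)"
      "(g has_derivative frechet_derivative g (at x)) (at x)"
      using Suc.prems that by (auto simp: frechet_derivative_works)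
    from has_derivative_add[OF this] show ?thesis
      by (rule frechet_derivative_at[THEN fun_cong, symmetric])
  qed
  have "Ck_on k S (\<lambda>x. frechet_derivative (\<lambda>x. f x + g x) (at x) v)" for v
    using Suc by (subst Ck_on_cong[OF assms(1) eq]) auto
  then show ?case using Suc.prems by (simp add: differentiable_add)
qed

lemma Ck_on_mult:
  fixes f g :: "'b::real_normed_vector \<Rightarrow> real"
  assumes "open S" "Ck_on k S f" "Ck_on k S g"
  shows "Ck_on k S (\<lambda>x. f x * g x)"
  using assms(2,3)
proof (induction k arbitrary: f g)
  case 0
  then show ?case by (simp add: continuous_on_mult)
next
  case (Suc k)
  have eq: "frechet_derivative (\<lambda>x. f x * g x) (at x) v =
      f x * frechet_derivative g (at x) v + frechet_derivative f (at x) v * g x"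
    if "x \<in> S" for x v
  proof -
    have "(f has_derivative frechet_derivative f (at x)) (at x)"
      "(g has_derivative frechet_derivative g (at x)) (at x)"
      using Suc.prems that by (auto simp: frechet_derivative_works)
    from has_derivative_mult[OF this] show ?thesis
      by (rule frechet_derivative_at[THEN fun_cong, symmetric])
  qed
  have "Ck_on k S (\<lambda>x. frechet_derivative (\<lambda>x. f x * g x) (at x) v)" for v
    using Suc Ck_on_decrease[OF Suc.prems(1)] Ck_on_decrease[OF Suc.prems(2)]
    by (subst Ck_on_cong[OF assms(1) eq]) (auto intro!: Ck_on_add[OF assms(1)])
  then show ?case using Suc.prems by (simp add: differentiable_mult)
qed

lemma scaleR_fun_apply [simp]: "(c *\<^sub>R f) x = c *\<^sub>R f x"
  by (simp add: scaleR_fun_def)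

lemma sum_fun_apply [simp]: "(sum f I) x = (\<Sum>i\<in>I. f i x)"
  for f :: "'i \<Rightarrow> 'a \<Rightarrow> 'b::comm_monoid_add"
  by (induction I rule: infinite_finite_induct) simp_all

locale manifold =
  fixes M :: "('a, 'b::real_normed_vector) atlas_space"
  assumes manifold: "smooth_manifold M"
begin

abbreviation (input) A where "A \<equiv> smooth_functions M"
abbreviation (input) V where "V \<equiv> vector_fields M"

lemma open_chart_image: "(U, \<phi>) \<in> charts M \<Longrightarrow> open (\<phi> ` U)"
  and chart_domain_subset: "(U, \<phi>) \<in> charts M \<Longrightarrow> U \<subseteq> points M"
  using manifold unfolding smooth_manifold_def by (fastforce dest: openin_subset)+

text \<open>Elements of the algebra of smooth functions vanish outside of the manifold, so its constants, and
in particular its unit, have to be cut off there.\<close>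

definition const_function :: "real \<Rightarrow> 'a \<Rightarrow> real"
  where "const_function c = (\<lambda>p. if p \<in> points M then c else 0)"

lemma smooth_const: "const_function c \<in> A"
proof -
  have "smooth_on (\<phi> ` U) (\<lambda>y. const_function c (inv_into U \<phi> y))" if U: "(U, \<phi>) \<in> charts M" for U \<phi>
  proof -
    have eq: "const_function c (inv_into U \<phi> y) = c" if "y \<in> \<phi> ` U" for y
      using chart_domain_subset[OF U] inv_into_into[OF that] by (auto simp: const_function_def)
    show ?thesis
      unfolding smooth_on_def
      by (auto simp: Ck_on_const Ck_on_cong[OF open_chart_image[OF U], where g = "\<lambda>_. c"] eq)
  qed
  then show ?thesis by (auto simp: smooth_functions_def const_function_def)
qed

lemma smooth_add: "f \<in> A \<Longrightarrow> g \<in> A \<Longrightarrow> f + g \<in> A"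
  by (auto simp: smooth_functions_def smooth_on_def intro!: Ck_on_add open_chart_image)

lemma smooth_mult: "f \<in> A \<Longrightarrow> g \<in> A \<Longrightarrow> f * g \<in> A"
  by (auto simp: smooth_functions_def smooth_on_def intro!: Ck_on_mult open_chart_image)

lemma smooth_outside: "f \<in> A \<Longrightarrow> p \<notin> points M \<Longrightarrow> f p = 0"
  by (simp add: smooth_functions_def)

lemma const_function_mult: "f \<in> A \<Longrightarrow> const_function c * f = c *\<^sub>R f"
  by (auto simp: const_function_def fun_eq_iff smooth_outside)

text \<open>Real scalars are treated as a special case of multiplication by smooth functions; in the same
way linearity over functions will give real linearity for vector fields and forms.\<close>

lemma smooth_scaleR: "f \<in> A \<Longrightarrow> c *\<^sub>R f \<in> A"
  using smooth_mult[OF smooth_const, of f c] by (simp add: const_function_mult)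

lemma smooth_zero [simp]: "0 \<in> A"
  using smooth_scaleR[OF smooth_const, of 0 0] by simp

lemma smooth_uminus: "f \<in> A \<Longrightarrow> - f \<in> A"
  using smooth_scaleR[of f "-1"] by simp

lemma smooth_diff: "f \<in> A \<Longrightarrow> g \<in> A \<Longrightarrow> f - g \<in> A"
  using smooth_add[OF _ smooth_uminus, of f g] by simp

section \<open>The Lie algebra of vector fields\<close>

text \<open>Being a derivation at every point and preserving smoothness amounts to being a derivation of the
algebra of smooth functions. The value at a point is recovered from \<open>act\<close>, so that the
conditions outside of the manifold are consequences of \<open>act X f\<close> being extended by zero. Identities
between vector fields can thus be checked by letting both sides act on functions.\<close>

lemma vector_fields_iff:
  "X \<in> V \<longleftrightarrow>
    (\<forall>f. f \<notin> A \<longrightarrow> act X f = 0) \<and> (\<forall>f\<in>A. act X f \<in> A) \<and>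
    (\<forall>f\<in>A. \<forall>g\<in>A. act X (f + g) = act X f + act X g \<and>
       act X (f * g) = f * act X g + g * act X f) \<and>
    (\<forall>c. \<forall>f\<in>A. act X (c *\<^sub>R f) = c *\<^sub>R act X f)" (is "_ \<longleftrightarrow> ?R")
proof
  assume X: "X \<in> V"
  then have t: "X p \<in> tangent_space M p \<or> X p = 0" for p
    by (auto simp: vector_fields_def)
  have "act X f = 0" if "f \<notin> A" for f
    using t that by (auto simp: act_def fun_eq_iff tangent_space_def)
  moreover have "act X (f + g) = act X f + act X g" "act X (f * g) = f * act X g + g * act X f"
    if "f \<in> A" "g \<in> A" for f g
  proof -
    have "X p (f + g) = X p f + X p g \<and> X p (f * g) = f p * X p g + g p * X p f" for p
      using t[of p] that by (auto simp: tangent_space_def)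
    then show "act X (f + g) = act X f + act X g" "act X (f * g) = f * act X g + g * act X f"
      by (auto simp: act_def fun_eq_iff)
  qed
  moreover have "act X (c *\<^sub>R f) = c *\<^sub>R act X f" if "f \<in> A" for c f
  proof -
    have "X p (c *\<^sub>R f) = c * X p f" for p
      using t[of p] that by (auto simp: tangent_space_def)
    then show ?thesis by (auto simp: act_def fun_eq_iff)
  qed
  ultimately show ?R using X by (simp add: vector_fields_def)
next
  assume R: ?R
  have "X p f = 0" if "p \<notin> points M" for p f
    using R that smooth_outside[of "act X f" p] by (cases "f \<in> A") (auto simp: act_def fun_eq_iff)
  moreover have "X p \<in> tangent_space M p" for p
    using R by (auto simp: act_def fun_eq_iff tangent_space_def)
  ultimately show "X \<in> V" using R by (auto simp: vector_fields_def fun_eq_iff)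
qed

lemma act_smooth: "X \<in> V \<Longrightarrow> act X f \<in> A"
  and act_add: "X \<in> V \<Longrightarrow> f \<in> A \<Longrightarrow> g \<in> A \<Longrightarrow> act X (f + g) = act X f + act X g"
  and act_mult: "X \<in> V \<Longrightarrow> f \<in> A \<Longrightarrow> g \<in> A \<Longrightarrow> act X (f * g) = f * act X g + g * act X f"
  and act_scaleR: "X \<in> V \<Longrightarrow> f \<in> A \<Longrightarrow> act X (c *\<^sub>R f) = c *\<^sub>R act X f"
  by (cases "f \<in> A"; simp add: vector_fields_iff)+

lemma act_zero [simp]: "X \<in> V \<Longrightarrow> act X 0 = 0"
  using act_scaleR[of X 0 0] by simp

lemma act_diff: "X \<in> V \<Longrightarrow> f \<in> A \<Longrightarrow> g \<in> A \<Longrightarrow> act X (f - g) = act X f - act X g"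
  using act_add[of X f "(-1) *\<^sub>R g"] act_scaleR[of X g "-1"] smooth_scaleR[of g "-1"] by simp

end

lemma vfield_eqI: "(\<And>f. act X f = act Y f) \<Longrightarrow> X = Y"
  by (simp add: act_def fun_eq_iff)

lemma act_plus: "act (X + Y) f = act X f + act Y f"
  and act_scaleR_field: "act (c *\<^sub>R X) f = c *\<^sub>R act X f"
  and act_fmult: "act (fmult g X) f = g * act X f"
  and act_lie_bracket: "act (lie_bracket X Y) f = act X (act Y f) - act Y (act X f)"
  and act_zero_field [simp]: "act 0 f = 0"
  by (simp_all add: act_def fun_eq_iff fmult_def lie_bracket_def)

lemma lie_bracket_antisym: "lie_bracket Y X = - lie_bracket X Y"
  by (simp add: lie_bracket_def fun_eq_iff)

lemma lie_bracket_self [simp]: "lie_bracket X X = 0"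
  by (simp add: lie_bracket_def fun_eq_iff)

context manifold
begin

lemma field_zero [simp]: "0 \<in> V"
  by (simp add: vector_fields_iff)

lemma field_add: "X \<in> V \<Longrightarrow> Y \<in> V \<Longrightarrow> X + Y \<in> V"
  by (simp add: vector_fields_iff act_plus smooth_add algebra_simps scaleR_add_right)

lemma field_fmult: "f \<in> A \<Longrightarrow> X \<in> V \<Longrightarrow> fmult f X \<in> V"
  by (simp add: vector_fields_iff act_fmult smooth_mult algebra_simps fun_eq_iff)

lemma fmult_const_function: "X \<in> V \<Longrightarrow> fmult (const_function c) X = c *\<^sub>R X"
  by (intro vfield_eqI) (simp add: act_fmult act_scaleR_field const_function_mult act_smooth)

lemma field_scaleR: "X \<in> V \<Longrightarrow> c *\<^sub>R X \<in> V"
  using field_fmult[OF smooth_const, of X c] by (simp add: fmult_const_function)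

text \<open>The commutator of two derivations is a derivation: in \<open>XY - YX\<close> applied to a product, the
mixed terms \<open>Xf * Yg + Yf * Xg\<close> cancel.\<close>

lemma field_lie_bracket:
  assumes X: "X \<in> V" and Y: "Y \<in> V"
  shows "lie_bracket X Y \<in> V"
  unfolding vector_fields_iff
proof (intro conjI allI ballI impI)
  fix f g assume fg: "f \<in> A" "g \<in> A"
  show "act (lie_bracket X Y) (f * g) = f * act (lie_bracket X Y) g + g * act (lie_bracket X Y) f"
    using fg X Y
    by (simp add: act_lie_bracket act_mult act_add smooth_mult act_smooth algebra_simps)
  show "act (lie_bracket X Y) (f + g) = act (lie_bracket X Y) f + act (lie_bracket X Y) g"
    using fg X Y by (simp add: act_lie_bracket act_add act_smooth)
next
  fix f assume "f \<notin> A"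
  then show "act (lie_bracket X Y) f = 0"
    using X Y by (simp add: act_lie_bracket vector_fields_iff[of X] vector_fields_iff[of Y])
qed (use X Y in \<open>auto simp: act_lie_bracket act_scaleR act_smooth smooth_diff scaleR_diff_right\<close>)

lemma lie_bracket_add_right:
  "X \<in> V \<Longrightarrow> Y \<in> V \<Longrightarrow> Z \<in> V \<Longrightarrow> lie_bracket X (Y + Z) = lie_bracket X Y + lie_bracket X Z"
  by (intro vfield_eqI) (simp add: act_lie_bracket act_plus act_add act_smooth)

lemma lie_bracket_fmult_right:
  "X \<in> V \<Longrightarrow> Y \<in> V \<Longrightarrow> f \<in> A \<Longrightarrow>
    lie_bracket X (fmult f Y) = fmult f (lie_bracket X Y) + fmult (act X f) Y"
  by (intro vfield_eqI)
    (simp add: act_lie_bracket act_plus act_fmult act_mult act_smooth algebra_simps)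

lemma lie_bracket_scaleR_right:
  "X \<in> V \<Longrightarrow> Y \<in> V \<Longrightarrow> lie_bracket X (c *\<^sub>R Y) = c *\<^sub>R lie_bracket X Y"
  by (intro vfield_eqI)
    (simp add: act_lie_bracket act_scaleR_field act_scaleR act_smooth scaleR_diff_right)

lemma lie_bracket_zero_right [simp]: "X \<in> V \<Longrightarrow> lie_bracket X 0 = 0"
  by (intro vfield_eqI) (simp add: act_lie_bracket)

lemma lie_bracket_zero_left [simp]: "X \<in> V \<Longrightarrow> lie_bracket 0 X = 0"
  by (intro vfield_eqI) (simp add: act_lie_bracket)

lemma lie_bracket_add_left:
  "X \<in> V \<Longrightarrow> Y \<in> V \<Longrightarrow> Z \<in> V \<Longrightarrow> lie_bracket (Y + Z) X = lie_bracket Y X + lie_bracket Z X"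
  by (simp add: lie_bracket_antisym[of _ X] lie_bracket_add_right)

lemma lie_bracket_scaleR_left:
  "X \<in> V \<Longrightarrow> Y \<in> V \<Longrightarrow> lie_bracket (c *\<^sub>R Y) X = c *\<^sub>R lie_bracket Y X"
  by (simp add: lie_bracket_antisym[of _ X] lie_bracket_scaleR_right)

lemma lie_bracket_jacobi:
  "X \<in> V \<Longrightarrow> Y \<in> V \<Longrightarrow> Z \<in> V \<Longrightarrow>
    lie_bracket X (lie_bracket Y Z) =
      lie_bracket (lie_bracket X Y) Z + lie_bracket Y (lie_bracket X Z)"
  by (intro vfield_eqI)
    (simp add: act_lie_bracket act_plus act_diff act_smooth)

end

section \<open>Removing list entries, and sums over pairs\<close>

text \<open>These are the recursions for the lists with one or two entries omitted in the invariant formula for \<open>d\<close>.\<close>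

lemma nths_Cons_Compl:
  "nths (x # xs) (- {0}) = xs"
  "nths (x # xs) (- {Suc i}) = x # nths xs (- {i})"
  "nths (x # xs) (- {0, Suc j}) = nths xs (- {j})"
  "nths (x # xs) (- {Suc i, Suc j}) = x # nths xs (- {i, j})"
proof -
  have "{j. Suc j \<in> - {0}} = UNIV" "{j. Suc j \<in> - {Suc i}} = - {i}"
    "{i. Suc i \<in> - {0, Suc j}} = - {j}" "{l. Suc l \<in> - {Suc i, Suc j}} = - {i, j}"
    by auto
  then show "nths (x # xs) (- {0}) = xs" "nths (x # xs) (- {Suc i}) = x # nths xs (- {i})"
    "nths (x # xs) (- {0, Suc j}) = nths xs (- {j})"
    "nths (x # xs) (- {Suc i, Suc j}) = x # nths xs (- {i, j})"
    unfolding nths_Cons by (simp_all add: nths_all)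
qed

lemma nths_remove: "nths xs (- {i}) = take i xs @ drop (Suc i) xs"
proof (induction xs arbitrary: i)
  case (Cons x xs)
  then show ?case by (cases i) (simp_all add: nths_Cons_Compl)
qed simp

lemma nths_remove_two:
  assumes "i < j"
  shows "nths xs (- {i, j}) = nths (nths xs (- {j})) (- {i})"
  using assms
proof (induction xs arbitrary: i j)
  case (Cons x xs)
  then obtain j' where "j = Suc j'" by (cases j) auto
  with Cons show ?case by (cases i) (simp_all add: nths_Cons_Compl)
qed simp

lemma nths_remove_snoc:
  "i < length vs \<Longrightarrow> nths (vs @ [v]) (- {i, length vs}) = nths vs (- {i})"
  "i < j \<Longrightarrow> j < length vs \<Longrightarrow> nths (vs @ [v]) (- {i, j}) = nths vs (- {i, j}) @ [v]"
  by (simp_all add: nths_remove_two nths_remove)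

text \<open>Splitting off the pairs that contain the first index separates, in the invariant formula for
\<open>d\<omega>(X, Y\<^sub>1, \<dots>)\<close>, the brackets with \<open>X\<close> from the others.\<close>

lemma sum_pairs_Suc:
  fixes f :: "nat \<Rightarrow> nat \<Rightarrow> 'c::comm_monoid_add"
  shows "(\<Sum>(i, j)\<in>{(i, j). i < j \<and> j < Suc m}. f i j) =
    (\<Sum>j<m. f 0 (Suc j)) + (\<Sum>(i, j)\<in>{(i, j). i < j \<and> j < m}. f (Suc i) (Suc j))"
proof -
  have fin: "finite {(i, j). i < j \<and> j < (m::nat)}"
    by (rule finite_subset[of _ "{..<m} \<times> {..<m}"]) auto
  have eq: "{(i, j). i < j \<and> j < Suc m} =
      (\<lambda>j. (0, Suc j)) ` {..<m} \<union> map_prod Suc Suc ` {(i, j). i < j \<and> j < m}" (is "_ = ?A \<union> ?B")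
  proof safe
    fix i j assume *: "i < j" "j < Suc m" "(i, j) \<notin> map_prod Suc Suc ` {(i, j). i < j \<and> j < m}"
    show "(i, j) \<in> (\<lambda>j. (0, Suc j)) ` {..<m}"
      using * by (cases i; cases j) (auto simp: map_prod_def)
  qed
  have "?A \<inter> ?B = {}" by auto
  then show ?thesis
    unfolding eq using fin
    by (subst sum.union_disjoint) (auto simp: sum.reindex inj_on_def split_def)
qed

text \<open>Contractions are extended at the end of the list, hence here the last index is split off.\<close>

lemma sum_pairs_Suc_last:
  fixes f :: "nat \<Rightarrow> nat \<Rightarrow> 'c::comm_monoid_add"
  shows "(\<Sum>(i, j)\<in>{(i, j). i < j \<and> j < Suc m}. f i j) =
    (\<Sum>(i, j)\<in>{(i, j). i < j \<and> j < m}. f i j) + (\<Sum>i<m. f i m)"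
proof -
  have fin: "finite {(i, j). i < j \<and> j < (m::nat)}"
    by (rule finite_subset[of _ "{..<m} \<times> {..<m}"]) auto
  have eq: "{(i, j). i < j \<and> j < Suc m} = {(i, j). i < j \<and> j < m} \<union> (\<lambda>i. (i, m)) ` {..<m}"
    by auto
  show ?thesis
    unfolding eq using fin by (subst sum.union_disjoint) (auto simp: sum.reindex inj_on_def)
qed

section \<open>Forms and interior products\<close>

lemma interior_apply: "interior X \<omega> Xs = \<omega> (X # Xs)"
  by (simp add: interior_def)

lemma interior_linear [simp]:
  "interior X (\<omega> + \<eta>) = interior X \<omega> + interior X \<eta>"
  "interior X (\<omega> - \<eta>) = interior X \<omega> - interior X \<eta>"
  "interior X (- \<omega>) = - interior X \<omega>"
  "interior X (c *\<^sub>R \<omega>) = c *\<^sub>R interior X \<omega>"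
  "interior X 0 = 0"
  by (simp_all add: interior_def fun_eq_iff)

definition fscale :: "('a \<Rightarrow> real) \<Rightarrow> 'a form \<Rightarrow> 'a form"
  where "fscale f \<omega> = (\<lambda>Xs. f * \<omega> Xs)"

lemma interior_fscale [simp]: "interior X (fscale f \<omega>) = fscale f (interior X \<omega>)"
  by (simp add: interior_def fscale_def fun_eq_iff)

text \<open>The Lie derivative is defined by the Leibniz rule and not by Cartan's formula, because it is
this expression that can be recognised in the invariant formula for \<open>d\<close>. Outside of the tuples
of vector fields it has to be set to zero in order to be a form.\<close>

definition lie_deriv :: "('a, 'b::real_normed_vector) atlas_space \<Rightarrow> 'a vfield \<Rightarrow> 'a form \<Rightarrow> 'a form"
  where "lie_deriv M X \<omega> = (\<lambda>Ys. if set Ys \<subseteq> vector_fields M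
    then act X (\<omega> Ys) - (\<Sum>i<length Ys. \<omega> (Ys[i := lie_bracket X (Ys ! i)])) else 0)"

context manifold
begin

abbreviation (input) "\<Omega> \<equiv> forms M"
abbreviation (input) "\<L> \<equiv> lie_deriv M"
abbreviation (input) "d \<equiv> ext_deriv M"

lemma form_support: "\<omega> \<in> \<Omega> k \<Longrightarrow> \<not> (length Xs = k \<and> set Xs \<subseteq> V) \<Longrightarrow> \<omega> Xs = 0"
  unfolding forms_def by blast

lemma form_smooth: "\<omega> \<in> \<Omega> k \<Longrightarrow> \<omega> Xs \<in> A"
  by (cases "length Xs = k \<and> set Xs \<subseteq> V") (auto simp: forms_def)

lemma form_update_add:
  assumes "\<omega> \<in> \<Omega> k" "set Xs \<subseteq> V" "i < length Xs" "X \<in> V" "Y \<in> V"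
  shows "\<omega> (Xs[i := X + Y]) = \<omega> (Xs[i := X]) + \<omega> (Xs[i := Y])"
proof (cases "length Xs = k")
  case True
  then show ?thesis using assms unfolding forms_def by blast
qed (simp add: form_support[OF assms(1)])

lemma form_update_fmult:
  assumes "\<omega> \<in> \<Omega> k" "set Xs \<subseteq> V" "i < length Xs" "X \<in> V" "f \<in> A"
  shows "\<omega> (Xs[i := fmult f X]) = f * \<omega> (Xs[i := X])"
proof (cases "length Xs = k")
  case True
  then show ?thesis using assms unfolding forms_def by blast
qed (simp add: form_support[OF assms(1)])

lemma form_update_scaleR:
  assumes "\<omega> \<in> \<Omega> k" "set Xs \<subseteq> V" "i < length Xs" "X \<in> V"
  shows "\<omega> (Xs[i := c *\<^sub>R X]) = c *\<^sub>R \<omega> (Xs[i := X])"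
  using form_update_fmult[OF assms smooth_const[of c]] assms
  by (simp add: fmult_const_function const_function_mult form_smooth[OF assms(1)])

lemma form_repeated:
  assumes "\<omega> \<in> \<Omega> k" "i < j" "j < length Xs" "Xs ! i = Xs ! j"
  shows "\<omega> Xs = 0"
proof (cases "length Xs = k \<and> set Xs \<subseteq> V")
  case True
  then show ?thesis using assms unfolding forms_def by blast
qed (simp add: form_support[OF assms(1)])

lemma form_zero_entry:
  assumes "\<omega> \<in> \<Omega> k" "0 \<in> set Xs"
  shows "\<omega> Xs = 0"
proof (cases "set Xs \<subseteq> V")
  case True
  obtain i where i: "i < length Xs" "Xs ! i = 0"
    using assms(2) by (auto simp: in_set_conv_nth)
  then have "Xs = Xs[i := 0 *\<^sub>R 0]"
    by (metis list_update_id scaleR_zero_left)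
  then show ?thesis
    using form_update_scaleR[OF assms(1) True i(1) field_zero, of 0] by simp
qed (simp add: form_support[OF assms(1)])

text \<open>Polarisation: evaluate the form with the sum of the two entries at both places.\<close>

lemma form_swap:
  assumes \<omega>: "\<omega> \<in> \<Omega> k" and ij: "i < j" "j < length Xs"
  shows "\<omega> (Xs[i := Xs ! j, j := Xs ! i]) = - \<omega> Xs"
proof (cases "set Xs \<subseteq> V")
  case True
  let ?a = "Xs ! i" and ?b = "Xs ! j"
  let ?F = "\<lambda>X Y. \<omega> (Xs[i := X, j := Y])"
  have ab: "?a \<in> V" "?b \<in> V" using True ij by auto
  then have in_V: "set (Xs[i := X]) \<subseteq> V" "set (Xs[j := X]) \<subseteq> V" if "X \<in> V" for X
    using True that by (meson insert_subset order_trans set_update_subset_insert)+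
  have add_right: "?F X (?a + ?b) = ?F X ?a + ?F X ?b" if "X \<in> V" for X
    using form_update_add[OF \<omega> in_V(1)] ij ab that by simp
  have add_left: "?F (?a + ?b) Y = ?F ?a Y + ?F ?b Y" if "Y \<in> V" for Y
    using form_update_add[OF \<omega> in_V(2), of Y i ?a ?b] ij ab that
    by (simp add: list_update_swap[of j i])
  have alt: "?F X X = 0" for X
    by (rule form_repeated[OF \<omega> ij(1)]) (use ij in auto)
  have "0 = ?F (?a + ?b) (?a + ?b)"
    by (simp only: alt)
  also have "\<dots> = (?F ?a ?a + ?F ?b ?a) + (?F ?a ?b + ?F ?b ?b)"
    using ab by (simp only: add_right add_left field_add)
  also have "\<dots> = ?F ?a ?b + ?F ?b ?a"
    by (simp only: alt add_0_left add_0_right add.commute)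
  finally have "?F ?b ?a = - ?F ?a ?b"
    by (metis add_eq_0_iff)
  then show ?thesis by simp
next
  case False
  moreover have "set (Xs[i := Xs ! j, j := Xs ! i]) = set Xs"
    using ij by (auto simp: set_swap)
  ultimately show ?thesis by (simp add: form_support[OF \<omega>])
qed

lemma forms_0_iff: "\<omega> \<in> \<Omega> 0 \<longleftrightarrow> \<omega> [] \<in> A \<and> (\<forall>Xs. Xs \<noteq> [] \<longrightarrow> \<omega> Xs = 0)"
  by (auto simp: forms_def)

text \<open>Together with \<open>forms_SucI\<close> below this gives a recursive description of forms in terms of their
interior products, by which statements about forms are proved by induction on the degree.\<close>

lemma forms_SucD:
  assumes \<omega>: "\<omega> \<in> \<Omega> (Suc k)"
  shows "\<omega> [] = 0"
    and "X \<notin> V \<Longrightarrow> interior X \<omega> = 0"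
    and "X \<in> V \<Longrightarrow> interior X \<omega> \<in> \<Omega> k"
proof -
  show "\<omega> [] = 0"
    using \<omega> by (simp add: forms_def)
  show "interior X \<omega> = 0" if "X \<notin> V"
    using \<omega> that by (auto simp: interior_def forms_def fun_eq_iff)
  show "interior X \<omega> \<in> \<Omega> k" if prems: "X \<in> V"
  proof -
    have "interior X \<omega> (Xs[i := Y + Z]) = interior X \<omega> (Xs[i := Y]) + interior X \<omega> (Xs[i := Z])"
      if "set Xs \<subseteq> V" "i < length Xs" "Y \<in> V" "Z \<in> V" for Xs i Y Z
      using form_update_add[OF \<omega>, of "X # Xs" "Suc i" Y Z] that prems by (simp add: interior_def)
    moreover have "interior X \<omega> (Xs[i := fmult f Y]) = f * interior X \<omega> (Xs[i := Y])"
      if "set Xs \<subseteq> V" "i < length Xs" "Y \<in> V" "f \<in> A" for Xs i Y f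
      using form_update_fmult[OF \<omega>, of "X # Xs" "Suc i" Y f] that prems by (simp add: interior_def)
    moreover have "interior X \<omega> Xs = 0" if "i < j" "j < length Xs" "Xs ! i = Xs ! j" for Xs i j
      using form_repeated[OF \<omega>, of "Suc i" "Suc j" "X # Xs"] that by (simp add: interior_def)
    moreover have "interior X \<omega> Xs \<in> A" for Xs
      by (simp add: interior_def form_smooth[OF \<omega>])
    moreover have "interior X \<omega> Xs = 0" if "\<not> (length Xs = k \<and> set Xs \<subseteq> V)" for Xs
      using that by (auto simp: interior_def intro!: form_support[OF \<omega>])
    ultimately show ?thesis unfolding forms_def by blast
  qed
qed

lemma interior_field_add:
  assumes \<omega>: "\<omega> \<in> \<Omega> k" and "X \<in> V" "Y \<in> V"
  shows "interior (X + Y) \<omega> = interior X \<omega> + interior Y \<omega>"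
proof
  fix Xs
  show "interior (X + Y) \<omega> Xs = (interior X \<omega> + interior Y \<omega>) Xs"
    using form_update_add[OF \<omega>, of "X # Xs" 0 X Y] assms form_support[OF \<omega>]
    by (cases "set Xs \<subseteq> V") (auto simp: interior_def)
qed

lemma interior_fmult:
  assumes \<omega>: "\<omega> \<in> \<Omega> k" and "X \<in> V" "f \<in> A"
  shows "interior (fmult f X) \<omega> = fscale f (interior X \<omega>)"
proof
  fix Xs
  show "interior (fmult f X) \<omega> Xs = fscale f (interior X \<omega>) Xs"
    using form_update_fmult[OF \<omega>, of "X # Xs" 0 X f] assms form_support[OF \<omega>]
    by (cases "set Xs \<subseteq> V") (auto simp: interior_def fscale_def)
qed

lemma interior_interior_same:
  assumes \<omega>: "\<omega> \<in> \<Omega> k"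
  shows "interior X (interior X \<omega>) = 0"
  using form_repeated[OF \<omega>, of 0 "Suc 0" "X # X # _"] by (auto simp: interior_def fun_eq_iff)

lemma interior_zero_field:
  assumes "\<omega> \<in> \<Omega> k"
  shows "interior 0 \<omega> = 0"
  using form_zero_entry[OF assms, of "0 # _"] by (simp add: interior_def fun_eq_iff)

lemma interior_anticommute:
  assumes \<omega>: "\<omega> \<in> \<Omega> k"
  shows "interior X (interior Y \<omega>) = - interior Y (interior X \<omega>)"
  using form_swap[OF \<omega>, of 0 "Suc 0" "X # Y # _"] by (auto simp: interior_def fun_eq_iff)

text \<open>All conditions on entries other than the first one are inherited from the interior products.
Only the alternation between the first and some later entry needs an argument: the tail is
alternating, so the repeated entry can be moved to the second place at the cost of a sign,
and there \<open>\<iota>\<^sub>X \<iota>\<^sub>X \<omega> = 0\<close> applies.\<close>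

lemma forms_SucI:
  assumes nil: "\<omega> [] = 0"
    and support: "\<And>X. X \<notin> V \<Longrightarrow> interior X \<omega> = 0"
    and form: "\<And>X. X \<in> V \<Longrightarrow> interior X \<omega> \<in> \<Omega> k"
    and add: "\<And>X Y. X \<in> V \<Longrightarrow> Y \<in> V \<Longrightarrow> interior (X + Y) \<omega> = interior X \<omega> + interior Y \<omega>"
    and fmult: "\<And>f X. f \<in> A \<Longrightarrow> X \<in> V \<Longrightarrow> interior (fmult f X) \<omega> = fscale f (interior X \<omega>)"
    and alt: "\<And>X. X \<in> V \<Longrightarrow> interior X (interior X \<omega>) = 0"
  shows "\<omega> \<in> \<Omega> (Suc k)"
proof -
  have Cons: "\<omega> (X # Xs) = interior X \<omega> Xs" for X Xs
    by (simp add: interior_def)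
  have zero: "\<omega> Xs = 0" if "\<not> (length Xs = Suc k \<and> set Xs \<subseteq> V)" for Xs
  proof (cases Xs)
    case (Cons X Ys)
    then show ?thesis
      using that support form_support[OF form, of X Ys] by (cases "X \<in> V") (auto simp: interior_apply[symmetric])
  qed (simp add: nil)
  have smooth: "\<omega> Xs \<in> A" for Xs
    using form_smooth[OF form] zero[of Xs]
    by (cases "length Xs = Suc k \<and> set Xs \<subseteq> V") (auto simp: length_Suc_conv Cons)
  have upd_add: "\<omega> (Xs[i := X + Y]) = \<omega> (Xs[i := X]) + \<omega> (Xs[i := Y])"
    if "length Xs = Suc k" "set Xs \<subseteq> V" "i < Suc k" "X \<in> V" "Y \<in> V" for Xs i X Y
    using that add form_update_add[OF form]
    by (cases i) (auto simp: length_Suc_conv Cons)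
  have upd_fmult: "\<omega> (Xs[i := fmult f X]) = f * \<omega> (Xs[i := X])"
    if "length Xs = Suc k" "set Xs \<subseteq> V" "i < Suc k" "X \<in> V" "f \<in> A" for Xs i X f
    using that fmult form_update_fmult[OF form]
    by (cases i) (auto simp: length_Suc_conv Cons fscale_def)
  have repeated: "\<omega> Xs = 0"
    if Xs: "length Xs = Suc k" "set Xs \<subseteq> V" and ij: "i < j" "j < Suc k" "Xs ! i = Xs ! j" for Xs i j
  proof -
    obtain X Ys where [simp]: "Xs = X # Ys" and X: "X \<in> V"
      using Xs by (auto simp: length_Suc_conv)
    note tail = form[OF X]
    obtain j' where [simp]: "j = Suc j'" using ij by (cases j) auto
    show ?thesis
    proof (cases i)
      case (Suc i')
      then show ?thesis using form_repeated[OF tail, of i' j' Ys] ij Xs by (simp add: Cons)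
    next
      case 0
      then have j': "Ys ! j' = X" "j' < length Ys" using ij Xs by auto
      show ?thesis
      proof (cases j')
        case 0
        with j' obtain Zs where "Ys = X # Zs" by (cases Ys) auto
        then show ?thesis using alt[OF X] by (simp add: interior_def fun_eq_iff)
      next
        case (Suc l)
        then obtain Zs where *: "Ys[0 := Ys ! j', j' := Ys ! 0] = X # Zs"
          using j' by (cases Ys) auto
        have "\<omega> Xs = - interior X \<omega> (Ys[0 := Ys ! j', j' := Ys ! 0])"
          using form_swap[OF tail, of 0 j' Ys] j' Suc by (simp add: Cons)
        also have "\<dots> = 0"
          using fun_cong[OF alt[OF X], of Zs] unfolding * by (simp add: interior_def)
        finally show ?thesis .
      qed
    qed
  qed
  show ?thesis
    unfolding forms_def mem_Collect_eq
    by (intro conjI allI impI ballI) (use zero smooth upd_add upd_fmult repeated in auto)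
qed

lemma form_ext:
  assumes "\<omega> \<in> \<Omega> (Suc k)" "\<eta> \<in> \<Omega> (Suc k)" "\<And>X. X \<in> V \<Longrightarrow> interior X \<omega> = interior X \<eta>"
  shows "\<omega> = \<eta>"
proof
  fix Xs
  show "\<omega> Xs = \<eta> Xs"
  proof (cases Xs)
    case (Cons X Ys)
    then show ?thesis
      using forms_SucD(2)[OF assms(1)] forms_SucD(2)[OF assms(2)] assms(3)
      by (metis interior_apply)
  qed (simp add: forms_SucD(1)[OF assms(1)] forms_SucD(1)[OF assms(2)])
qed

lemma form_0_ext: "\<omega> \<in> \<Omega> 0 \<Longrightarrow> \<eta> \<in> \<Omega> 0 \<Longrightarrow> \<omega> [] = \<eta> [] \<Longrightarrow> \<omega> = \<eta>"
  unfolding forms_0_iff fun_eq_iff[of \<omega>] by metis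

lemma form_fscale: "\<omega> \<in> \<Omega> k \<Longrightarrow> f \<in> A \<Longrightarrow> fscale f \<omega> \<in> \<Omega> k"
  unfolding forms_def mem_Collect_eq fscale_def
  by (auto simp: smooth_mult distrib_left mult.left_commute)

lemma form_add: "\<omega> \<in> \<Omega> k \<Longrightarrow> \<eta> \<in> \<Omega> k \<Longrightarrow> \<omega> + \<eta> \<in> \<Omega> k"
  unfolding forms_def mem_Collect_eq
  by (auto simp: smooth_add distrib_left)

lemma fscale_const_function: "\<omega> \<in> \<Omega> k \<Longrightarrow> fscale (const_function c) \<omega> = c *\<^sub>R \<omega>"
  by (simp add: fscale_def fun_eq_iff[of _ "c *\<^sub>R \<omega>"] const_function_mult form_smooth)

lemma form_scaleR: "\<omega> \<in> \<Omega> k \<Longrightarrow> c *\<^sub>R \<omega> \<in> \<Omega> k"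
  using form_fscale[OF _ smooth_const] by (metis fscale_const_function)

lemma form_zero [simp]: "0 \<in> \<Omega> k"
  by (simp add: forms_def)

lemma form_diff: "\<omega> \<in> \<Omega> k \<Longrightarrow> \<eta> \<in> \<Omega> k \<Longrightarrow> \<omega> - \<eta> \<in> \<Omega> k"
  using form_add[OF _ form_scaleR, of \<omega> k \<eta> "-1"] by simp

section \<open>Lie derivative\<close>

lemma lie_deriv_Nil: "\<L> X \<omega> [] = act X (\<omega> [])"
  by (simp add: lie_deriv_def)

lemma lie_deriv_add:
  assumes "\<omega> \<in> \<Omega> k" "\<eta> \<in> \<Omega> l" "X \<in> V"
  shows "\<L> X (\<omega> + \<eta>) = \<L> X \<omega> + \<L> X \<eta>"
proof
  fix Ys
  show "\<L> X (\<omega> + \<eta>) Ys = (\<L> X \<omega> + \<L> X \<eta>) Ys"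
    using assms by (simp add: lie_deriv_def act_add form_smooth sum.distrib)
qed

lemma lie_deriv_fscale:
  assumes "\<omega> \<in> \<Omega> k" "f \<in> A" "X \<in> V"
  shows "\<L> X (fscale f \<omega>) = fscale f (\<L> X \<omega>) + fscale (act X f) \<omega>"
proof
  fix Ys
  show "\<L> X (fscale f \<omega>) Ys = (fscale f (\<L> X \<omega>) + fscale (act X f) \<omega>) Ys"
    using assms form_support[OF assms(1), of Ys]
    by (auto simp: lie_deriv_def fscale_def act_mult form_smooth sum_distrib_left right_diff_distrib mult.commute)
qed

lemma lie_deriv_scaleR:
  assumes "\<omega> \<in> \<Omega> k" "X \<in> V"
  shows "\<L> X (c *\<^sub>R \<omega>) = c *\<^sub>R \<L> X \<omega>"
proof
  fix Ys
  show "\<L> X (c *\<^sub>R \<omega>) Ys = (c *\<^sub>R \<L> X \<omega>) Ys"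
    using assms by (simp add: lie_deriv_def act_scaleR form_smooth scaleR_sum_right scaleR_diff_right)
qed

lemma lie_deriv_zero [simp]: "X \<in> V \<Longrightarrow> \<L> X 0 = 0"
  using lie_deriv_scaleR[of 0 0 X 0] by simp

lemma lie_deriv_diff:
  assumes "\<omega> \<in> \<Omega> k" "\<eta> \<in> \<Omega> l" "X \<in> V"
  shows "\<L> X (\<omega> - \<eta>) = \<L> X \<omega> - \<L> X \<eta>"
  using lie_deriv_add[OF assms(1) form_scaleR[OF assms(2), of "-1"] assms(3)]
    lie_deriv_scaleR[OF assms(2,3), of "-1"] by simp

lemma lie_deriv_field_add:
  assumes "\<omega> \<in> \<Omega> k" "X \<in> V" "Y \<in> V"
  shows "\<L> (X + Y) \<omega> = \<L> X \<omega> + \<L> Y \<omega>"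
proof
  fix Zs
  have "\<omega> (Zs[i := lie_bracket (X + Y) (Zs ! i)]) =
      \<omega> (Zs[i := lie_bracket X (Zs ! i)]) + \<omega> (Zs[i := lie_bracket Y (Zs ! i)])"
    if "set Zs \<subseteq> V" "i < length Zs" for i
  proof -
    have "Zs ! i \<in> V" using that by auto
    then show ?thesis
      using that assms by (simp only: lie_bracket_add_left form_update_add[OF assms(1)] field_lie_bracket)
  qed
  then show "\<L> (X + Y) \<omega> Zs = (\<L> X \<omega> + \<L> Y \<omega>) Zs"
    by (simp add: lie_deriv_def act_plus sum.distrib)
qed

text \<open>The identity \<open>[L\<^sub>X, \<iota>\<^sub>Y] = \<iota>\<^bsub>[X,Y]\<^esub>\<close>: in the Leibniz rule, the summand for the first entry
is the one that is subtracted.\<close>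

lemma interior_lie_deriv:
  assumes \<omega>: "\<omega> \<in> \<Omega> k" and Y: "Y \<in> V"
  shows "interior Y (\<L> X \<omega>) = \<L> X (interior Y \<omega>) - interior (lie_bracket X Y) \<omega>"
proof
  fix Zs
  show "interior Y (\<L> X \<omega>) Zs = (\<L> X (interior Y \<omega>) - interior (lie_bracket X Y) \<omega>) Zs"
    using Y form_support[OF \<omega>, of "lie_bracket X Y # Zs"]
    by (simp add: interior_def lie_deriv_def sum.lessThan_Suc_shift del: sum.lessThan_Suc)
qed

lemma interior_lie_deriv_outside: "Y \<notin> V \<Longrightarrow> interior Y (\<L> X \<omega>) = 0"
  by (simp add: interior_def lie_deriv_def fun_eq_iff)

text \<open>By induction on the degree. Linearity over functions in the first entry holds because
\<open>(Xf) \<iota>\<^sub>Y\<omega>\<close> occurs twice with opposite signs: from differentiating \<open>f \<iota>\<^sub>Y\<omega>\<close> and from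
\<open>[X, fY] = f [X, Y] + (Xf) Y\<close>.\<close>

lemma form_lie_deriv:
  assumes "\<omega> \<in> \<Omega> k" "X \<in> V"
  shows "\<L> X \<omega> \<in> \<Omega> k"
  using assms(1)
proof (induction k arbitrary: \<omega>)
  case 0
  then have \<omega>: "\<omega> [] \<in> A" "Xs \<noteq> [] \<Longrightarrow> \<omega> Xs = 0" for Xs by (auto simp: forms_0_iff)
  have "\<L> X \<omega> Xs = 0" if "Xs \<noteq> []" for Xs
    using that \<omega>(2)[of "Xs[_ := _]"] by (simp add: lie_deriv_def \<omega> assms(2))
  then show ?case
    using \<omega> assms(2) by (simp add: forms_0_iff lie_deriv_Nil act_smooth)
next
  case (Suc k)
  note \<omega> = Suc.prems
  note [simp] = interior_lie_deriv[OF \<omega>]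
  show ?case
  proof (rule forms_SucI)
    show "\<L> X \<omega> [] = 0"
      using assms(2) by (simp add: lie_deriv_Nil forms_SucD(1)[OF \<omega>])
    fix Y assume Y: "Y \<in> V"
    note XY = field_lie_bracket[OF assms(2) Y]
    show "interior Y (\<L> X \<omega>) \<in> \<Omega> k"
      using Y XY by (simp add: form_diff Suc.IH forms_SucD(3)[OF \<omega>])
    show "interior Y (interior Y (\<L> X \<omega>)) = 0"
      using Y XY assms(2) interior_lie_deriv[OF forms_SucD(3)[OF \<omega> Y] Y]
      by (simp add: interior_interior_same[OF \<omega>] interior_anticommute[OF \<omega>, of "lie_bracket X Y" Y])
    fix Z assume Z: "Z \<in> V"
    show "interior (Y + Z) (\<L> X \<omega>) = interior Y (\<L> X \<omega>) + interior Z (\<L> X \<omega>)"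
      using Y Z assms(2) forms_SucD(3)[OF \<omega>]
      by (simp add: field_add interior_field_add[OF \<omega>] lie_bracket_add_right
          lie_deriv_add[where k = k and l = k] field_lie_bracket)
  next
    fix f Y assume f: "f \<in> A" and Y: "Y \<in> V"
    show "interior (fmult f Y) (\<L> X \<omega>) = fscale f (interior Y (\<L> X \<omega>))"
      using f Y assms(2) forms_SucD(3)[OF \<omega>]
      by (simp add: field_fmult lie_bracket_fmult_right interior_field_add[OF \<omega>]
          interior_fmult[OF \<omega>] field_lie_bracket act_smooth lie_deriv_fscale[where k = k])
       (simp add: fscale_def fun_eq_iff right_diff_distrib)
  qed (simp add: interior_lie_deriv_outside)
qed

text \<open>On functions this is the definition of the bracket. In the induction step, the interior
products of the two sides differ by \<open>\<iota>\<close> of the Jacobi identity.\<close>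

lemma lie_deriv_lie_bracket:
  assumes "\<omega> \<in> \<Omega> k" "X \<in> V" "Y \<in> V"
  shows "\<L> (lie_bracket X Y) \<omega> = \<L> X (\<L> Y \<omega>) - \<L> Y (\<L> X \<omega>)"
  using assms(1)
proof (induction k arbitrary: \<omega>)
  case 0
  then show ?case
    using assms(2,3)
    by (intro form_0_ext form_diff form_lie_deriv field_lie_bracket)
      (auto simp: lie_deriv_Nil act_lie_bracket)
next
  case (Suc k)
  note \<omega> = Suc.prems
  note int = forms_SucD(3)[OF \<omega>]
  show ?case
  proof (rule form_ext[where k = k])
    fix Z assume Z: "Z \<in> V"
    have "interior Z (\<L> X (\<L> Y \<omega>)) = \<L> X (\<L> Y (interior Z \<omega>)) - \<L> X (interior (lie_bracket Y Z) \<omega>)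
        - \<L> Y (interior (lie_bracket X Z) \<omega>) + interior (lie_bracket Y (lie_bracket X Z)) \<omega>"
      if "X \<in> V" "Y \<in> V" for X Y
      using that Z \<omega> by (simp add: interior_lie_deriv[OF form_lie_deriv] interior_lie_deriv[OF \<omega>]
          field_lie_bracket lie_deriv_diff[OF form_lie_deriv[OF int] int] int)
    then show "interior Z (\<L> (lie_bracket X Y) \<omega>) = interior Z (\<L> X (\<L> Y \<omega>) - \<L> Y (\<L> X \<omega>))"
      using assms(2,3) Z
      by (simp add: interior_lie_deriv[OF \<omega>] Suc.IH[OF int] lie_bracket_jacobi[of X Y Z]
          interior_field_add[OF \<omega>] field_lie_bracket)
        (simp add: fun_eq_iff)
  next
    show "\<L> (lie_bracket X Y) \<omega> \<in> \<Omega> (Suc k)" "\<L> X (\<L> Y \<omega>) - \<L> Y (\<L> X \<omega>) \<in> \<Omega> (Suc k)"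
      using assms(2,3) \<omega> by (simp_all add: form_diff form_lie_deriv field_lie_bracket)
  qed
qed

section \<open>Exterior derivative\<close>

lemma ext_deriv_add:
  assumes "\<omega> \<in> \<Omega> k" "\<eta> \<in> \<Omega> l"
  shows "d (\<omega> + \<eta>) = d \<omega> + d \<eta>"
proof
  fix Xs
  show "d (\<omega> + \<eta>) Xs = (d \<omega> + d \<eta>) Xs"
  proof (cases "set Xs \<subseteq> V")
    case True
    then have "act (Xs ! i) (\<omega> Ys + \<eta> Ys) = act (Xs ! i) (\<omega> Ys) + act (Xs ! i) (\<eta> Ys)"
      if "i < length Xs" for i Ys
      using that assms by (intro act_add) (auto simp: form_smooth)
    then show ?thesis
      by (simp add: ext_deriv_def scaleR_add_right sum.distrib split_def)
  qed (simp add: ext_deriv_def)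
qed

lemma ext_deriv_scaleR:
  assumes "\<omega> \<in> \<Omega> k"
  shows "d (c *\<^sub>R \<omega>) = c *\<^sub>R d \<omega>"
proof
  fix Xs
  show "d (c *\<^sub>R \<omega>) Xs = (c *\<^sub>R d \<omega>) Xs"
  proof (cases "set Xs \<subseteq> V")
    case True
    then have "act (Xs ! i) (c *\<^sub>R \<omega> Ys) = c *\<^sub>R act (Xs ! i) (\<omega> Ys)"
      if "i < length Xs" for i Ys
      using that assms by (intro act_scaleR) (auto simp: form_smooth)
    then show ?thesis
      by (simp add: ext_deriv_def scaleR_add_right scaleR_sum_right split_def mult.commute[of c])
  qed (simp add: ext_deriv_def)
qed

lemma ext_deriv_zero [simp]: "d 0 = 0"
  using ext_deriv_scaleR[of 0 0 0] by simp

lemma ext_deriv_uminus: "\<omega> \<in> \<Omega> k \<Longrightarrow> d (- \<omega>) = - d \<omega>"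
  using ext_deriv_scaleR[of \<omega> k "-1"] by simp

lemma ext_deriv_diff:
  assumes "\<omega> \<in> \<Omega> k" "\<eta> \<in> \<Omega> l"
  shows "d (\<omega> - \<eta>) = d \<omega> - d \<eta>"
  using ext_deriv_add[OF assms(1) form_scaleR[OF assms(2), of "-1"]]
    ext_deriv_scaleR[OF assms(2), of "-1"] by simp

text \<open>The tail \<open>Ys\<close> is there for later use with contractions, where further arguments follow.\<close>

lemma form_move_to_front:
  assumes "\<omega> \<in> \<Omega> k" "set Xs \<subseteq> V" "i < length Xs"
  shows "\<omega> (Xs[i := Z] @ Ys) = (-1) ^ i *\<^sub>R \<omega> (Z # nths Xs (- {i}) @ Ys)"
  using assms
proof (induction i arbitrary: Xs k \<omega>)
  case 0
  then show ?case by (cases Xs) (auto simp: nths_Cons_Compl)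
next
  case (Suc i)
  then obtain X Ws where Xs: "Xs = X # Ws" by (cases Xs) auto
  have X: "X \<in> V" using Suc.prems Xs by auto
  obtain l where "\<omega> \<in> \<Omega> (Suc l) \<or> k = 0" using Suc.prems(1) by (cases k) auto
  then show ?case
  proof
    assume \<omega>: "\<omega> \<in> \<Omega> (Suc l)"
    have "\<omega> (Xs[Suc i := Z] @ Ys) = interior X \<omega> (Ws[i := Z] @ Ys)"
      by (simp add: Xs interior_def)
    also have "\<dots> = (-1) ^ i *\<^sub>R interior X \<omega> (Z # nths Ws (- {i}) @ Ys)"
      using Suc.prems Xs by (intro Suc.IH[OF forms_SucD(3)[OF \<omega> X]]) auto
    also have "interior X \<omega> (Z # nths Ws (- {i}) @ Ys) = - \<omega> (Z # X # nths Ws (- {i}) @ Ys)"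
      using fun_cong[OF interior_anticommute[OF \<omega>, of Z X]] by (simp add: interior_def)
    also have "(-1) ^ i *\<^sub>R - \<omega> (Z # X # nths Ws (- {i}) @ Ys) =
        (-1) ^ Suc i *\<^sub>R \<omega> (Z # nths Xs (- {Suc i}) @ Ys)"
      by (simp add: Xs nths_Cons_Compl)
    finally show ?thesis .
  next
    assume "k = 0"
    then show ?thesis using Suc.prems form_support[OF Suc.prems(1)] Xs by simp
  qed
qed

text \<open>Cartan's formula. In the invariant formula for \<open>d\<omega>(X, Y\<^sub>1, \<dots>, Y\<^sub>m)\<close>, the terms in which \<open>X\<close>
acts or is bracketed make up \<open>L\<^sub>X\<omega>(Y\<^sub>1, \<dots>, Y\<^sub>m)\<close>, once \<open>[X, Y\<^sub>j]\<close> has been moved back to the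
\<open>j\<close>-th place. The other terms are those of \<open>d(\<iota>\<^sub>X\<omega>)(Y\<^sub>1, \<dots>, Y\<^sub>m)\<close> with the opposite sign: by
the shift of \<open>i\<close> in the first sum, and by interchanging \<open>X\<close> with \<open>[Y\<^sub>i, Y\<^sub>j]\<close> in the second.\<close>

lemma interior_ext_deriv:
  assumes \<omega>: "\<omega> \<in> \<Omega> k" and X: "X \<in> V"
  shows "interior X (d \<omega>) = \<L> X \<omega> - d (interior X \<omega>)"
proof
  fix Ys
  show "interior X (d \<omega>) Ys = (\<L> X \<omega> - d (interior X \<omega>)) Ys"
  proof (cases "set Ys \<subseteq> V")
    case True
    let ?m = "length Ys"
    have swap: "\<omega> (X # Y # Zs) = - \<omega> (Y # X # Zs)" for Y Zs
      using fun_cong[OF interior_anticommute[OF \<omega>, of Y X], of Zs] by (simp add: interior_def)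
    have move: "\<omega> (Ys[j := Z]) = (-1) ^ j *\<^sub>R \<omega> (Z # nths Ys (- {j}))" if "j < ?m" for j Z
      using form_move_to_front[OF \<omega> True that, of Z "[]"] by simp
    have "interior X (d \<omega>) Ys =
        act X (\<omega> Ys) + (\<Sum>i<?m. (-1) ^ Suc i *\<^sub>R act (Ys ! i) (\<omega> (X # nths Ys (- {i})))) +
        ((\<Sum>j<?m. (-1) ^ Suc j *\<^sub>R \<omega> (lie_bracket X (Ys ! j) # nths Ys (- {j}))) +
        (\<Sum>(i, j)\<in>{(i, j). i < j \<and> j < ?m}. (-1) ^ (Suc i + Suc j) *\<^sub>R
          \<omega> (lie_bracket (Ys ! i) (Ys ! j) # X # nths Ys (- {i, j}))))"
      using True X
      by (simp add: interior_def ext_deriv_def sum_pairs_Suc sum.lessThan_Suc_shift nths_Cons_Compl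
          del: sum.lessThan_Suc)
    also have "\<dots> = \<L> X \<omega> Ys - d (interior X \<omega>) Ys"
      using True
      by (simp add: lie_deriv_def ext_deriv_def interior_def move swap sum_negf split_def)
    finally show ?thesis by simp
  qed (simp add: interior_def ext_deriv_def lie_deriv_def)
qed

lemma interior_ext_deriv_outside: "X \<notin> V \<Longrightarrow> interior X (d \<omega>) = 0"
  by (simp add: interior_def ext_deriv_def fun_eq_iff)

lemma ext_deriv_Nil: "d \<omega> [] = 0"
  by (simp add: ext_deriv_def)

text \<open>In positive degree, \<open>\<iota>\<^sub>X d\<omega> = L\<^sub>X\<omega> - d \<iota>\<^sub>X\<omega>\<close> is a form by induction, and
\<open>\<iota>\<^sub>X \<iota>\<^sub>X d\<omega> = [\<iota>\<^sub>X, L\<^sub>X]\<omega> + d \<iota>\<^sub>X \<iota>\<^sub>X \<omega> = 0\<close>. Linearity over functions in the first entry would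
require the formula for \<open>L\<^bsub>fX\<^esub>\<close>; it is obtained instead by interchanging the first two entries.
In degree \<open>0\<close>, where there is no second entry, it is immediate.\<close>

lemma form_ext_deriv:
  assumes "\<omega> \<in> \<Omega> k"
  shows "d \<omega> \<in> \<Omega> (Suc k)"
  using assms
proof (induction k arbitrary: \<omega>)
  case 0
  note \<omega> = this
  then have int0: "interior X \<omega> = 0" for X
    by (auto simp: forms_0_iff interior_def fun_eq_iff)
  have int: "interior X (d \<omega>) = \<L> X \<omega>" if "X \<in> V" for X
    using interior_ext_deriv[OF \<omega> that] by (simp add: int0)
  show ?case
  proof (rule forms_SucI)
    fix f X assume f: "f \<in> A" and X: "X \<in> V"
    show "interior (fmult f X) (d \<omega>) = fscale f (interior X (d \<omega>))"
      using f X \<omega>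
      by (intro form_0_ext) (simp_all add: int field_fmult form_lie_deriv form_fscale lie_deriv_Nil
          fscale_def[of f] act_fmult, simp_all add: fscale_def[symmetric] form_fscale form_lie_deriv)
  next
    fix X assume X: "X \<in> V"
    show "interior X (interior X (d \<omega>)) = 0"
      using X form_lie_deriv[OF \<omega> X]
      by (auto simp: int forms_0_iff interior_def[of _ "lie_deriv _ _ _"] fun_eq_iff)
  qed (use \<omega> in \<open>auto simp: int field_add form_lie_deriv lie_deriv_field_add[OF \<omega>]
      interior_ext_deriv_outside ext_deriv_Nil\<close>)
next
  case (Suc k)
  note \<omega> = Suc.prems
  note int = forms_SucD(3)[OF \<omega>]
  note d = interior_ext_deriv[OF \<omega>]
  have form: "interior X (d \<omega>) \<in> \<Omega> (Suc k)" if "X \<in> V" for X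
    using that by (simp add: d form_diff form_lie_deriv[OF \<omega>] Suc.IH[OF int])
  have add: "interior (X + Y) (d \<omega>) = interior X (d \<omega>) + interior Y (d \<omega>)"
    if "X \<in> V" "Y \<in> V" for X Y
    using that by (simp add: d field_add lie_deriv_field_add[OF \<omega>] interior_field_add[OF \<omega>]
        ext_deriv_add[OF int int])
  have alt: "interior X (interior X (d \<omega>)) = 0" if "X \<in> V" for X
    using that by (simp add: d interior_lie_deriv[OF \<omega>] interior_ext_deriv[OF int]
        interior_interior_same[OF \<omega>] interior_zero_field[OF \<omega>])
  \<comment> \<open>As for forms, alternation and additivity imply antisymmetry by polarisation.\<close>
  have anti: "interior X (interior Y (d \<omega>)) = - interior Y (interior X (d \<omega>))"
    if XY: "X \<in> V" "Y \<in> V" for X Y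
  proof -
    have "0 = interior (X + Y) (interior (X + Y) (d \<omega>))"
      using XY by (simp add: alt field_add)
    also have "\<dots> = interior X (interior Y (d \<omega>)) + interior Y (interior X (d \<omega>))"
      using XY by (simp add: add interior_field_add[OF form] alt)
    finally show ?thesis unfolding eq_neg_iff_add_eq_0 by (rule sym)
  qed
  have fmult: "interior (fmult f X) (d \<omega>) = fscale f (interior X (d \<omega>))"
    if f: "f \<in> A" and X: "X \<in> V" for f X
  proof (rule form_ext[where k = k])
    fix Y assume Y: "Y \<in> V"
    have "interior Y (interior (fmult f X) (d \<omega>)) = - fscale f (interior X (interior Y (d \<omega>)))"
      using f X Y by (simp add: anti[OF Y field_fmult[OF f X]] interior_fmult[OF form])
    also have "\<dots> = fscale f (interior Y (interior X (d \<omega>)))"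
      using anti[OF X Y] by (simp add: fscale_def fun_eq_iff)
    finally show "interior Y (interior (fmult f X) (d \<omega>)) = interior Y (fscale f (interior X (d \<omega>)))"
      by simp
  next
    show "interior (fmult f X) (d \<omega>) \<in> \<Omega> (Suc k)" "fscale f (interior X (d \<omega>)) \<in> \<Omega> (Suc k)"
      using f X by (simp_all add: form field_fmult form_fscale)
  qed
  show ?case
    by (rule forms_SucI[OF ext_deriv_Nil interior_ext_deriv_outside form add fmult alt])
qed

text \<open>Apply \<open>\<iota>\<^sub>Y\<close> to both sides, move it inside by the commutation rules, and use
\<open>[L\<^sub>X, L\<^sub>Y] = L\<^bsub>[X,Y]\<^esub>\<close>; what remains is the claim for \<open>\<iota>\<^sub>Y\<omega>\<close>.\<close>

lemma ext_deriv_lie_deriv: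
  assumes "\<omega> \<in> \<Omega> k" "X \<in> V"
  shows "d (\<L> X \<omega>) = \<L> X (d \<omega>)"
  using assms(1)
proof (induction k arbitrary: \<omega>)
  case 0
  note \<omega> = this
  then have int0: "interior X \<omega> = 0" if "\<omega> \<in> \<Omega> 0" for X \<omega>
    using that by (auto simp: forms_0_iff interior_def fun_eq_iff)
  show ?case
  proof (rule form_ext[where k = 0])
    fix Y assume Y: "Y \<in> V"
    show "interior Y (d (\<L> X \<omega>)) = interior Y (\<L> X (d \<omega>))"
      using Y assms(2) \<omega>
      by (simp add: interior_ext_deriv[where k = 0] form_lie_deriv int0
          interior_lie_deriv[OF form_ext_deriv[OF \<omega>]] field_lie_bracket lie_deriv_lie_bracket[OF \<omega>])
  qed (use assms(2) \<omega> in \<open>simp_all add: form_ext_deriv form_lie_deriv\<close>)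
next
  case (Suc k)
  note \<omega> = Suc.prems
  note int = forms_SucD(3)[OF \<omega>]
  note X = assms(2)
  show ?case
  proof (rule form_ext[where k = "Suc k"])
    fix Y assume Y: "Y \<in> V"
    note XY = field_lie_bracket[OF X Y]
    have "interior Y (d (\<L> X \<omega>)) =
        \<L> Y (\<L> X \<omega>) - \<L> X (d (interior Y \<omega>)) + d (interior (lie_bracket X Y) \<omega>)"
      using X Y XY
      by (simp add: interior_ext_deriv[OF form_lie_deriv[OF \<omega>]] interior_lie_deriv[OF \<omega>]
          ext_deriv_diff[OF form_lie_deriv[OF int] int] Suc.IH[OF int])
    also have "\<dots> = interior Y (\<L> X (d \<omega>))"
      using X Y XY
      by (simp add: interior_lie_deriv[OF form_ext_deriv[OF \<omega>]] interior_ext_deriv[OF \<omega>]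
          lie_deriv_diff[OF form_lie_deriv[OF \<omega>] form_ext_deriv[OF int]] lie_deriv_lie_bracket[OF \<omega>])
    finally show "interior Y (d (\<L> X \<omega>)) = interior Y (\<L> X (d \<omega>))" .
  qed (use assms(2) \<omega> in \<open>simp_all add: form_ext_deriv form_lie_deriv\<close>)
qed

text \<open>By induction, \<open>\<iota>\<^sub>X d d \<omega> = L\<^sub>X d\<omega> - d (L\<^sub>X\<omega> - d \<iota>\<^sub>X\<omega>) = [L\<^sub>X, d]\<omega> + d d \<iota>\<^sub>X\<omega> = 0\<close>.\<close>

lemma ext_deriv_ext_deriv:
  assumes "\<omega> \<in> \<Omega> k"
  shows "d (d \<omega>) = 0"
  using assms
proof (induction k arbitrary: \<omega>)
  case 0
  note \<omega> = this
  have "interior X \<omega> = 0" for X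
    using \<omega> by (auto simp: forms_0_iff interior_def fun_eq_iff)
  then have "interior X (d (d \<omega>)) = interior X 0" if X: "X \<in> V" for X
    unfolding interior_ext_deriv[OF form_ext_deriv[OF \<omega>] X] interior_ext_deriv[OF \<omega> X]
    by (simp add: ext_deriv_lie_deriv[OF \<omega> X])
  then show ?case
    by (rule form_ext[OF form_ext_deriv[OF form_ext_deriv[OF \<omega>]] form_zero])
next
  case (Suc k)
  note \<omega> = Suc.prems
  note int = forms_SucD(3)[OF \<omega>]
  have "interior X (d (d \<omega>)) = interior X 0" if X: "X \<in> V" for X
    unfolding interior_ext_deriv[OF form_ext_deriv[OF \<omega>] X] interior_ext_deriv[OF \<omega> X]
      ext_deriv_diff[OF form_lie_deriv[OF \<omega> X] form_ext_deriv[OF int[OF X]]]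
    by (simp add: fun_eq_iff ext_deriv_lie_deriv[OF \<omega> X] Suc.IH[OF int[OF X]])
  then show ?case
    by (rule form_ext[OF form_ext_deriv[OF form_ext_deriv[OF \<omega>]] form_zero])
qed

end

section \<open>Contraction with several vector fields\<close>

text \<open>From here on, forms and families of forms are mostly handled as elements of a vector space; sums
of them are only unfolded to values where this is asked for.\<close>

lemmas pointwise = fun_eq_iff plus_fun_apply minus_apply uminus_apply zero_fun_apply
  times_fun_apply scaleR_fun_apply sum_fun_apply

declare plus_fun_apply [simp del] minus_apply [simp del] uminus_apply [simp del]
  zero_fun_apply [simp del] times_fun_apply [simp del] scaleR_fun_apply [simp del]
  sum_fun_apply [simp del]

lemma contract_apply: "contract vs \<omega> Xs = \<omega> (vs @ Xs)"
  by (induction vs arbitrary: \<omega>) (simp_all add: contract_def interior_def)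

lemma contract_Nil [simp]: "contract [] \<omega> = \<omega>"
  by (simp add: contract_def)

lemma contract_Cons: "contract (v # vs) \<omega> = contract vs (interior v \<omega>)"
  by (simp add: contract_def)

lemma contract_snoc: "contract (vs @ [v]) \<omega> = interior v (contract vs \<omega>)"
  by (simp add: contract_def)

lemma contract_add: "contract vs (\<omega> + \<eta>) = contract vs \<omega> + contract vs \<eta>"
  by (simp add: pointwise contract_apply)

lemma contract_zero: "contract vs 0 = 0"
  by (simp add: pointwise contract_apply)

lemma interior_sum: "interior v (sum f I) = (\<Sum>i\<in>I. interior v (f i))"
  by (simp add: pointwise interior_def)

context manifold
begin

text \<open>The truncated subtraction is harmless, as \<open>0\<close> is a form of every degree. This avoids bounds
on the number of contracted vector fields.\<close>

lemma form_interior: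
  assumes "\<omega> \<in> \<Omega> k" "X \<in> V"
  shows "interior X \<omega> \<in> \<Omega> (k - 1)"
proof (cases k)
  case 0
  then have "interior X \<omega> = 0"
    using assms by (auto simp: forms_0_iff interior_def pointwise)
  then show ?thesis by simp
next
  case (Suc l)
  then show ?thesis using forms_SucD(3)[of \<omega> l X] assms by simp
qed

lemma interior_scaleR_field:
  assumes "\<omega> \<in> \<Omega> k" "X \<in> V"
  shows "interior (c *\<^sub>R X) \<omega> = c *\<^sub>R interior X \<omega>"
  using interior_fmult[OF assms smooth_const[of c]] assms
  by (simp add: fmult_const_function fscale_const_function[OF form_interior[OF assms]])

lemma form_contract: "\<omega> \<in> \<Omega> k \<Longrightarrow> set vs \<subseteq> V \<Longrightarrow> contract vs \<omega> \<in> \<Omega> (k - length vs)"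
proof (induction vs arbitrary: \<omega> k)
  case (Cons v vs)
  then show ?case using Cons.IH[OF form_interior[OF Cons.prems(1)], of v] by (simp add: contract_Cons)
qed simp

lemma contract_too_long: "\<omega> \<in> \<Omega> k \<Longrightarrow> k < length vs \<Longrightarrow> contract vs \<omega> = 0"
  by (auto simp: pointwise contract_apply form_support)

text \<open>\<open>L\<^sub>X\<close> is a derivation of contractions, by iterating \<open>[L\<^sub>X, \<iota>\<^sub>v] = \<iota>\<^bsub>[X,v]\<^esub>\<close>.\<close>

lemma lie_deriv_contract:
  assumes "\<omega> \<in> \<Omega> k" "X \<in> V" "set vs \<subseteq> V"
  shows "\<L> X (contract vs \<omega>) =
    contract vs (\<L> X \<omega>) + (\<Sum>i<length vs. contract (vs[i := lie_bracket X (vs ! i)]) \<omega>)"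
  using assms(1,3)
proof (induction vs arbitrary: \<omega> k)
  case (Cons v vs)
  then have v: "v \<in> V" and vs: "set vs \<subseteq> V" by auto
  have "\<L> X (interior v \<omega>) = interior v (\<L> X \<omega>) + interior (lie_bracket X v) \<omega>"
    using interior_lie_deriv[OF Cons.prems(1) v, of X] by simp
  then show ?case
    using Cons.IH[OF form_interior[OF Cons.prems(1) v] vs]
    by (simp add: contract_Cons contract_add sum.lessThan_Suc_shift add.assoc del: sum.lessThan_Suc)
qed simp

text \<open>The hypotheses give \<open>L\<^bsub>v\<^esub>\<omega> = 0\<close> for all entries \<open>v\<close>. Let \<open>\<eta>\<close> be the contraction with all but the last
entry \<open>v\<close>. Then \<open>d \<iota>\<^sub>v \<eta> = L\<^sub>v \<eta> - \<iota>\<^sub>v d\<eta>\<close>, where \<open>L\<^sub>v \<eta>\<close> only consists of the terms with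
\<open>[v, v\<^sub>i]\<close> in place of \<open>v\<^sub>i\<close>, which are the pairs involving \<open>v\<close>, while \<open>\<iota>\<^sub>v d\<eta>\<close> provides the
remaining pairs by induction.\<close>

lemma ext_deriv_contract:
  assumes \<omega>: "\<omega> \<in> \<Omega> k" and closed: "d \<omega> = 0"
    and vs: "set vs \<subseteq> V" "\<And>v. v \<in> set vs \<Longrightarrow> d (interior v \<omega>) = 0"
  shows "d (contract vs \<omega>) = (-1) ^ length vs *\<^sub>R
    (\<Sum>(i, j)\<in>{(i, j). i < j \<and> j < length vs}. (-1) ^ (i + j) *\<^sub>R
      contract (lie_bracket (vs ! i) (vs ! j) # nths vs (- {i, j})) \<omega>)"
  using vs
proof (induction vs rule: rev_induct)
  case Nil
  then show ?case by (simp add: closed)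
next
  case (snoc v vs)
  let ?m = "length vs" and ?\<eta> = "contract vs \<omega>"
  let ?P = "{(i, j). i < j \<and> j < ?m}"
  let ?C = "\<lambda>i. contract (lie_bracket (vs ! i) v # nths vs (- {i})) \<omega>"
  let ?D = "\<lambda>i j. contract (lie_bracket (vs ! i) (vs ! j) # nths vs (- {i, j}) @ [v]) \<omega>"
  have v: "v \<in> V" and vs: "set vs \<subseteq> V" using snoc.prems by auto
  have "\<L> v \<omega> = 0"
    using interior_ext_deriv[OF \<omega> v] snoc.prems(2)[of v] by (simp add: closed)
  moreover have "contract (vs[i := lie_bracket v (vs ! i)]) \<omega> = - ((-1) ^ i *\<^sub>R ?C i)" if "i < ?m" for i
  proof
    fix Xs
    have vi: "lie_bracket (vs ! i) v \<in> V"
      using that vs v by (intro field_lie_bracket) auto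
    have "interior (lie_bracket v (vs ! i)) \<omega> = - interior (lie_bracket (vs ! i) v) \<omega>"
      using interior_scaleR_field[OF \<omega> vi, of "-1"] lie_bracket_antisym[of v "vs ! i"] by simp
    then have "\<omega> (lie_bracket v (vs ! i) # Ys) = - \<omega> (lie_bracket (vs ! i) v # Ys)" for Ys
      by (simp add: interior_def pointwise)
    then show "contract (vs[i := lie_bracket v (vs ! i)]) \<omega> Xs = (- ((-1) ^ i *\<^sub>R ?C i)) Xs"
      using form_move_to_front[OF \<omega> vs that, of _ Xs] by (simp add: contract_apply pointwise)
  qed
  ultimately have lie: "\<L> v ?\<eta> = - (\<Sum>i<?m. (-1) ^ i *\<^sub>R ?C i)"
    using lie_deriv_contract[OF \<omega> v vs] by (simp add: contract_zero sum_negf)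
  have "d (contract (vs @ [v]) \<omega>) = \<L> v ?\<eta> - interior v (d ?\<eta>)"
    using interior_ext_deriv[OF form_contract[OF \<omega> vs] v] by (simp add: contract_snoc)
  also have "interior v (d ?\<eta>) = (-1) ^ ?m *\<^sub>R (\<Sum>(i, j)\<in>?P. (-1) ^ (i + j) *\<^sub>R ?D i j)"
    using snoc by (simp add: interior_sum split_def contract_snoc[symmetric])
  also have "\<L> v ?\<eta> - \<dots> = (-1) ^ Suc ?m *\<^sub>R ((\<Sum>(i, j)\<in>?P. (-1) ^ (i + j) *\<^sub>R ?D i j) +
      (\<Sum>i<?m. (-1) ^ (i + ?m) *\<^sub>R ?C i))"
    unfolding lie
    by (simp add: scaleR_add_right scaleR_sum_right power_add mult.commute[of "(-1) ^ _" "(-1) ^ ?m"]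
        mult.assoc[symmetric] power_mult_distrib[symmetric] sum_negf)
  also have "(\<Sum>(i, j)\<in>?P. (-1) ^ (i + j) *\<^sub>R ?D i j) + (\<Sum>i<?m. (-1) ^ (i + ?m) *\<^sub>R ?C i) =
      (\<Sum>(i, j)\<in>{(i, j). i < j \<and> j < length (vs @ [v])}. (-1) ^ (i + j) *\<^sub>R
        contract (lie_bracket ((vs @ [v]) ! i) ((vs @ [v]) ! j) # nths (vs @ [v]) (- {i, j})) \<omega>)"
    unfolding length_append_singleton sum_pairs_Suc_last
    by (intro arg_cong2[of _ _ _ _ "(+)"] sum.cong refl)
      (auto simp: nth_append nths_remove_snoc)
  finally show ?case
    unfolding length_append_singleton .
qed

end

section \<open>Permutations and shuffles\<close>

lemma permute_list_transpose:
  assumes "i < length xs" "j < length xs"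
  shows "permute_list (Transposition.transpose i j) xs = xs[i := xs ! j, j := xs ! i]"
  using assms
  by (intro nth_equalityI)
    (auto simp: permute_list_nth permutes_swap_id nth_list_update Transposition.transpose_def)

text \<open>Every permutation is a product of transpositions, so interchanges of two entries suffice.\<close>

lemma alternating_permute_list:
  fixes F :: "'c list \<Rightarrow> 'd::real_vector"
  assumes swap: "\<And>xs i j. length xs = k \<Longrightarrow> i < j \<Longrightarrow> j < k \<Longrightarrow> F (xs[i := xs ! j, j := xs ! i]) = - F xs"
    and "\<sigma> permutes {..<k}" "length xs = k"
  shows "F (permute_list \<sigma> xs) = of_int (sign \<sigma>) *\<^sub>R F xs"
  using finite_lessThan assms(2)
proof (induction rule: permutes_rev_induct)
  case id
  then show ?case by simp
next
  case (swap a b p)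
  define ys where "ys = permute_list p xs"
  have len: "length ys = k" by (simp add: ys_def assms(3))
  have ab: "a < k" "b < k" using swap.hyps by auto
  have "F (permute_list (p \<circ> Transposition.transpose a b) xs) =
      F (permute_list (Transposition.transpose a b) ys)"
    using ab assms(3) by (simp add: ys_def permute_list_compose permutes_swap_id)
  also have "\<dots> = F (ys[a := ys ! b, b := ys ! a])"
    using ab len by (simp add: permute_list_transpose)
  also have "\<dots> = - F ys"
    using assms(1)[OF len, of a b] assms(1)[OF len, of b a] ab swap.hyps(3)
    by (cases a b rule: linorder_cases) (simp_all add: list_update_swap[of a b])
  also have "\<dots> = of_int (sign (p \<circ> Transposition.transpose a b)) *\<^sub>R F xs"
    using swap.hyps swap.IH permutes_imp_permutation[OF finite_lessThan swap.hyps(4)]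
    by (simp add: ys_def sign_compose permutation_swap_id sign_swap_id)
  finally show ?case .
qed

text \<open>The cycle that brings the entry with index \<open>j\<close> to the front and keeps the order of the others. As a
product of \<open>j\<close> neighbour transpositions it has an evident sign.\<close>

fun to_front :: "nat \<Rightarrow> nat \<Rightarrow> nat" where
  "to_front 0 = id"
| "to_front (Suc j) = Transposition.transpose j (Suc j) \<circ> to_front j"

lemma to_front_apply: "to_front j k = (if k = 0 then j else if k \<le> j then k - 1 else k)"
  by (induction j) (auto simp: Transposition.transpose_def)

lemma to_front_permutes: "j < m \<Longrightarrow> to_front j permutes {..<m}"
  by (induction j) (auto simp: permutes_id intro!: permutes_compose permutes_swap_id simp del: id_apply)

lemma sign_to_front: "sign (to_front j) = (-1) ^ j"
proof (induction j)
  case (Suc j)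
  have "permutation (to_front j)"
    using to_front_permutes[of j "Suc j"] by (auto simp: permutation_permutes)
  then show ?case
    unfolding to_front.simps using Suc by (subst sign_compose) (simp_all add: permutation_swap_id sign_swap_id)
qed (simp add: sign_id)

lemma permute_list_to_front:
  assumes "j < length xs"
  shows "permute_list (to_front j) xs = xs ! j # nths xs (- {j})"
proof (rule nth_equalityI)
  show "length (permute_list (to_front j) xs) = length (xs ! j # nths xs (- {j}))"
    using assms by (simp add: nths_remove)
  fix k assume "k < length (permute_list (to_front j) xs)"
  then show "permute_list (to_front j) xs ! k = (xs ! j # nths xs (- {j})) ! k"
    using assms to_front_permutes[OF assms]
    by (cases k) (auto simp: permute_list_nth to_front_apply nths_remove nth_append min_def)
qed

text \<open>First \<open>j\<close> is brought to the front. Since \<open>i < j\<close>, this moves \<open>i\<close> up by one, whence the successor.\<close>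

definition pair_shuffle :: "nat \<Rightarrow> nat \<Rightarrow> nat \<Rightarrow> nat"
  where "pair_shuffle i j = to_front j \<circ> to_front (Suc i)"

lemma pair_shuffle_apply: "pair_shuffle i j k = to_front j (to_front (Suc i) k)"
  by (simp add: pair_shuffle_def del: to_front.simps)

lemma pair_shuffle_permutes: "i < j \<Longrightarrow> j < m \<Longrightarrow> pair_shuffle i j permutes {..<m}"
  unfolding pair_shuffle_def by (intro permutes_compose to_front_permutes) auto

lemma sign_pair_shuffle: "sign (pair_shuffle i j) = (-1) ^ Suc (i + j)"
proof -
  have "permutation (to_front j)" for j
    using to_front_permutes[of j "Suc j"] by (auto simp: permutation_permutes)
  then show ?thesis
    by (simp only: pair_shuffle_def sign_compose sign_to_front) (simp add: power_add)
qed

lemma permute_list_pair_shuffle: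
  assumes "i < j" "j < length xs"
  shows "permute_list (pair_shuffle i j) xs = xs ! i # xs ! j # nths xs (- {i, j})"
proof -
  have "permute_list (pair_shuffle i j) xs =
      permute_list (to_front (Suc i)) (xs ! j # nths xs (- {j}))"
    using assms by (simp only: pair_shuffle_def permute_list_compose to_front_permutes
        less_trans_Suc permute_list_to_front)
  also have "\<dots> = xs ! i # xs ! j # nths xs (- {i, j})"
    using assms
    by (subst permute_list_to_front) (auto simp: nths_Cons_Compl nths_remove_two, auto simp: nths_remove nth_append)
  finally show ?thesis .
qed

lemma shuffle_increasing:
  assumes "\<sigma> \<in> shuffles_of i m"
  shows "sorted (map \<sigma> [i..<m])" and "distinct (map \<sigma> [i..<m])"
proof -
  have \<sigma>: "\<sigma> permutes {..<m}" "\<And>a. Suc a < m \<Longrightarrow> Suc a \<noteq> i \<Longrightarrow> \<sigma> a < \<sigma> (Suc a)"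
    using assms by (auto simp: shuffles_of_def)
  show "sorted (map \<sigma> [i..<m])"
    unfolding sorted_iff_nth_Suc using \<sigma>(2) by (auto intro!: less_imp_le)
  show "distinct (map \<sigma> [i..<m])"
    using permutes_inj_on[OF \<sigma>(1)] by (simp add: distinct_map)
qed

text \<open>A shuffle is determined by its first two values: the rest enumerates the complement in
increasing order.\<close>

lemma shuffles_of_2: "shuffles_of 2 m = (\<lambda>(i, j). pair_shuffle i j) ` {(i, j). i < j \<and> j < m}"
  if "2 \<le> m"
proof (intro equalityI subsetI)
  fix \<sigma> assume "\<sigma> \<in> (\<lambda>(i, j). pair_shuffle i j) ` {(i, j). i < j \<and> j < m}"
  then obtain i j where ij: "i < j" "j < m" and \<sigma>: "\<sigma> = pair_shuffle i j" by auto
  have "pair_shuffle i j a < pair_shuffle i j (Suc a)" if "Suc a \<noteq> 2" for a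
    using ij that by (auto simp: pair_shuffle_apply to_front_apply simp del: to_front.simps split: if_splits)
  then show "\<sigma> \<in> shuffles_of 2 m"
    using pair_shuffle_permutes[OF ij] by (simp add: shuffles_of_def \<sigma>)
next
  fix \<sigma> assume \<sigma>: "\<sigma> \<in> shuffles_of 2 m"
  then have perm: "\<sigma> permutes {..<m}" and "\<sigma> 0 < \<sigma> 1"
    using that by (auto simp: shuffles_of_def)
  moreover have "\<sigma> 1 < m"
    using permutes_in_image[OF perm, of 1] that by simp
  ultimately obtain i j where \<sigma>01: "\<sigma> 0 = i" "\<sigma> 1 = j" and ij: "i < j" "j < m" by blast
  define \<tau> where "\<tau> = pair_shuffle i j"
  have \<tau>_perm: "\<tau> permutes {..<m}"
    unfolding \<tau>_def by (rule pair_shuffle_permutes[OF ij])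
  have \<tau>: "\<tau> \<in> shuffles_of 2 m"
  proof -
    have "\<tau> a < \<tau> (Suc a)" if "Suc a \<noteq> 2" for a
      using ij that unfolding \<tau>_def
      by (auto simp: pair_shuffle_apply to_front_apply simp del: to_front.simps split: if_splits)
    then show ?thesis using \<tau>_perm by (simp add: shuffles_of_def)
  qed
  have \<tau>01: "\<tau> 0 = i" "\<tau> 1 = j"
    using ij unfolding \<tau>_def
    by (auto simp: pair_shuffle_apply to_front_apply simp del: to_front.simps split: if_splits)
  have split: "{2..<m} = {..<m} - {0, 1}" using that by auto
  have "\<rho> ` {2..<m} = {..<m} - {\<rho> 0, \<rho> 1}" if "\<rho> permutes {..<m}" for \<rho>
    unfolding split using permutes_image[OF that] permutes_inj[OF that]
    by (simp add: image_set_diff)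
  then have "set (map \<sigma> [2..<m]) = set (map \<tau> [2..<m])"
    using perm \<tau>_perm \<tau>01 \<sigma>01 by simp
  then have "map \<sigma> [2..<m] = map \<tau> [2..<m]"
    using shuffle_increasing[OF \<sigma>] shuffle_increasing[OF \<tau>] by (intro sorted_distinct_set_unique)
  then have tail: "\<sigma> a = \<tau> a" if "2 \<le> a" "a < m" for a
    using that by simp
  have "\<sigma> a = \<tau> a" for a
  proof -
    consider "a = 0" | "a = 1" | "2 \<le> a" "a < m" | "m \<le> a" by linarith
    then show ?thesis
    proof cases
      case 4
      then show ?thesis
        using permutes_not_in[OF perm, of a] permutes_not_in[OF \<tau>_perm, of a] by simp
    qed (simp_all add: tail \<tau>01[unfolded One_nat_def] \<sigma>01[unfolded One_nat_def])
  qed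
  then have "\<sigma> = (\<lambda>(i, j). pair_shuffle i j) (i, j)" by (auto simp: \<tau>_def)
  then show "\<sigma> \<in> (\<lambda>(i, j). pair_shuffle i j) ` {(i, j). i < j \<and> j < m}"
    by (rule image_eqI) (use ij in simp)
qed

lemma inj_on_pair_shuffle: "inj_on (\<lambda>(i, j). pair_shuffle i j) {(i, j). i < j \<and> j < m}"
proof (rule inj_onI, safe)
  fix i j i' j' assume ij: "i < j" "i' < j'" and eq: "pair_shuffle i j = pair_shuffle i' j'"
  have "pair_shuffle i j 0 = i" "pair_shuffle i j 1 = j" if "i < j" for i j
    using that by (auto simp: pair_shuffle_apply to_front_apply simp del: to_front.simps split: if_splits)
  then show "i = i'" "j = j'" using ij eq by metis+
qed

lemma shuffles_of_all: "shuffles_of m m = {id}"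
proof (intro equalityI subsetI)
  fix \<sigma> assume "\<sigma> \<in> shuffles_of m m"
  then have perm: "\<sigma> permutes {..<m}" and "\<sigma> \<in> shuffles_of 0 m"
    by (auto simp: shuffles_of_def)
  then have "map \<sigma> [0..<m] = map id [0..<m]"
    using shuffle_increasing[of \<sigma> 0 m] permutes_image[OF perm]
    by (intro sorted_distinct_set_unique) (auto simp: atLeast0LessThan)
  then have "\<sigma> a = id a" for a
    using permutes_not_in[OF perm, of a] by (cases "a < m") (auto simp del: map_eq_conv simp: list_eq_iff_nth_eq)
  then show "\<sigma> \<in> {id}" by auto
qed (auto simp: shuffles_of_def permutes_id)

lemma koszul_sign_even: "(\<And>x. x \<in> set xs \<Longrightarrow> even (fst x)) \<Longrightarrow> \<sigma> permutes {..<length xs} \<Longrightarrow> koszul_sign \<sigma> xs = 1"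
  unfolding koszul_sign_def
proof (intro prod.neutral ballI)
  fix p assume even: "\<And>x. x \<in> set xs \<Longrightarrow> even (fst x)" and \<sigma>: "\<sigma> permutes {..<length xs}"
    and "p \<in> {(a, b). a < b \<and> b < length xs \<and> \<sigma> b < \<sigma> a}"
  then obtain a b where p: "p = (a, b)" "a < length xs" by auto
  have "\<sigma> a < length xs" using permutes_in_image[OF \<sigma>, of a] p by simp
  then show "(case p of (a, b) \<Rightarrow> if odd (fst (xs ! \<sigma> a) * fst (xs ! \<sigma> b)) then - 1 else 1) = (1::int)"
    using even[of "xs ! \<sigma> a"] p by simp
qed

section \<open>The multibrackets\<close>

text \<open>This is the property of \<open>\<varsigma>\<close> that makes the Jacobi identity work: it compensates the sign \<open>(-1)\<^sup>m\<close>
in the formula for \<open>d\<close> of a contraction.\<close>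

lemma varsigma_Suc: "varsigma k = (-1) ^ Suc k * varsigma (Suc k)"
proof -
  have "Suc k * (Suc k + 1) = k * (k + 1) + Suc k * 2" by simp
  then have "Suc k * (Suc k + 1) div 2 = k * (k + 1) div 2 + Suc k" by simp
  then show ?thesis
    unfolding varsigma_def by (simp only: power_add) (simp flip: power_mult_distrib mult.assoc)
qed

abbreviation fields :: "(int \<times> 'a vfield \<times> 'a form) list \<Rightarrow> 'a vfield list"
  where "fields xs \<equiv> map (\<lambda>x. fst (snd x)) xs"

text \<open>The brackets of at least two arguments of total degree \<open>0\<close> depend on the vector fields of the
arguments alone; this is their value in terms of these. For two arguments \<open>\<varsigma>\<close> is \<open>1\<close>, so that the form component needs no case distinction.\<close>

definition multibracket :: "'a form \<Rightarrow> 'a vfield list \<Rightarrow> 'a vfield \<times> 'a form"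
  where "multibracket \<omega> vs =
    (if length vs = 2 then lie_bracket (vs ! 0) (vs ! 1) else 0,
     varsigma (length vs) *\<^sub>R contract vs \<omega>)"

lemma Ham_bracket_1: "Ham_bracket M \<omega> 1 [(p, x)] = (if p < 0 then (0, ext_deriv M (snd x)) else 0)"
  by (simp add: Ham_bracket_def degree_of_def)

lemma Ham_bracket_eq_multibracket:
  assumes "length xs = k" "2 \<le> k"
  shows "Ham_bracket M \<omega> k xs = (if degree_of xs = 0 then multibracket \<omega> (fields xs) else 0)"
proof -
  have "fields xs = map (\<lambda>i. fst (snd (xs ! i))) [0..<k]"
    using assms by (intro nth_equalityI) auto
  moreover have "[0..<2] = [0, 1::nat]" by (simp add: upt_rec)
  ultimately show ?thesis
    using assms by (auto simp: Ham_bracket_def multibracket_def Let_def varsigma_def)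
qed

lemma degree_of_update:
  "i < length xs \<Longrightarrow> degree_of (xs[i := (p, y)]) = degree_of xs - fst (xs ! i) + p"
  unfolding degree_of_def
proof (induction xs arbitrary: i)
  case (Cons x xs)
  then show ?case by (cases i) auto
qed simp

lemma degree_of_zero: "(\<And>x. x \<in> set xs \<Longrightarrow> fst x = 0) \<Longrightarrow> degree_of xs = 0"
  unfolding degree_of_def by (induction xs) auto

lemma koszul_sign_id: "koszul_sign id xs = 1"
  unfolding koszul_sign_def by (rule prod.neutral) auto

lemma length_2D: "length xs = 2 \<Longrightarrow> \<exists>x y. xs = [x, y]"
  by (auto simp: numeral_2_eq_2 length_Suc_conv)

context manifold
begin

lemma multibracket_zero_entry:
  assumes "\<omega> \<in> \<Omega> l" "set vs \<subseteq> V" "0 \<in> set vs"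
  shows "multibracket \<omega> vs = 0"
proof -
  have "contract vs \<omega> = 0"
    using assms by (auto simp: pointwise contract_apply form_zero_entry)
  moreover have "lie_bracket (vs ! 0) (vs ! 1) = 0" if len: "length vs = 2"
  proof -
    obtain v w where "vs = [v, w]"
      using length_2D[OF len] by blast
    then show ?thesis using assms by auto
  qed
  ultimately show ?thesis by (simp add: multibracket_def zero_prod_def)
qed

lemma multibracket_swap:
  assumes "\<omega> \<in> \<Omega> l" "i < j" "j < length vs"
  shows "multibracket \<omega> (vs[i := vs ! j, j := vs ! i]) = - multibracket \<omega> vs"
proof -
  have "contract (vs[i := vs ! j, j := vs ! i]) \<omega> = - contract vs \<omega>"
  proof
    fix Xs
    show "contract (vs[i := vs ! j, j := vs ! i]) \<omega> Xs = (- contract vs \<omega>) Xs"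
      unfolding uminus_apply[of "contract vs \<omega>"] contract_apply
      using form_swap[OF assms(1,2), of "vs @ Xs"] assms(2,3)
      by (simp add: nth_append list_update_append)
  qed
  moreover have "lie_bracket (vs[i := vs ! j, j := vs ! i] ! 0) (vs[i := vs ! j, j := vs ! i] ! 1) =
      - lie_bracket (vs ! 0) (vs ! 1)" if len: "length vs = 2"
  proof -
    obtain v w where vw: "vs = [v, w]"
      using length_2D[OF len] by blast
    moreover have "i = 0" "j = 1" using len assms by linarith+
    ultimately show ?thesis using lie_bracket_antisym[of w v] by simp
  qed
  ultimately show ?thesis by (simp add: multibracket_def)
qed

lemma multibracket_update_add:
  assumes "\<omega> \<in> \<Omega> l" "set vs \<subseteq> V" "i < length vs" "X \<in> V" "Y \<in> V"
  shows "multibracket \<omega> (vs[i := X + Y]) = multibracket \<omega> (vs[i := X]) + multibracket \<omega> (vs[i := Y])"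
proof -
  have "\<omega> (vs[i := X + Y] @ Xs) = \<omega> (vs[i := X] @ Xs) + \<omega> (vs[i := Y] @ Xs)" for Xs
    using form_update_add[OF assms(1), of "vs @ Xs" i X Y] assms form_support[OF assms(1)]
    by (cases "set Xs \<subseteq> V") (auto simp: list_update_append)
  then have "contract (vs[i := X + Y]) \<omega> = contract (vs[i := X]) \<omega> + contract (vs[i := Y]) \<omega>"
    by (simp add: contract_apply plus_fun_apply fun_eq_iff)
  moreover have "lie_bracket (vs[i := X + Y] ! 0) (vs[i := X + Y] ! 1) =
      lie_bracket (vs[i := X] ! 0) (vs[i := X] ! 1) + lie_bracket (vs[i := Y] ! 0) (vs[i := Y] ! 1)"
    if len: "length vs = 2"
  proof -
    obtain v w where "vs = [v, w]"
      using length_2D[OF len] by blast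
    then show ?thesis
      using assms by (cases i) (auto simp: lie_bracket_add_left lie_bracket_add_right)
  qed
  ultimately show ?thesis by (simp add: multibracket_def scaleR_add_right)
qed

lemma multibracket_update_scaleR:
  assumes "\<omega> \<in> \<Omega> l" "set vs \<subseteq> V" "i < length vs" "X \<in> V"
  shows "multibracket \<omega> (vs[i := c *\<^sub>R X]) = c *\<^sub>R multibracket \<omega> (vs[i := X])"
proof -
  have "\<omega> (vs[i := c *\<^sub>R X] @ Xs) = c *\<^sub>R \<omega> (vs[i := X] @ Xs)" for Xs
    using form_update_scaleR[OF assms(1), of "vs @ Xs" i X c] assms form_support[OF assms(1)]
    by (cases "set Xs \<subseteq> V") (auto simp: list_update_append)
  then have "contract (vs[i := c *\<^sub>R X]) \<omega> = c *\<^sub>R contract (vs[i := X]) \<omega>"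
    by (simp add: contract_apply scaleR_fun_apply fun_eq_iff)
  moreover have "lie_bracket (vs[i := c *\<^sub>R X] ! 0) (vs[i := c *\<^sub>R X] ! 1) =
      c *\<^sub>R lie_bracket (vs[i := X] ! 0) (vs[i := X] ! 1)"
    if len: "length vs = 2"
  proof -
    obtain v w where "vs = [v, w]"
      using length_2D[OF len] by blast
    then show ?thesis
      using assms by (cases i) (auto simp: lie_bracket_scaleR_left lie_bracket_scaleR_right)
  qed
  ultimately show ?thesis by (simp add: multibracket_def scaleR_Pair)
qed

end

section \<open>The \<open>L\<^sub>\<infinity>\<close> structure\<close>

locale pre_n_plectic_manifold = manifold M for M :: "('a, 'b::real_normed_vector) atlas_space" +
  fixes n :: nat and \<omega> :: "'a form"
  assumes n: "1 \<le> n" and \<omega>: "\<omega> \<in> forms M (n + 1)" and closed: "ext_deriv M \<omega> = 0"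
begin

abbreviation (input) "L \<equiv> Ham_space n M \<omega>"
abbreviation (input) "l \<equiv> Ham_bracket M \<omega>"

lemma Ham_space_0: "(v, \<alpha>) \<in> L 0 \<longleftrightarrow> v \<in> V \<and> \<alpha> \<in> \<Omega> (n - 1) \<and> d \<alpha> = - interior v \<omega>"
  by (auto simp: Ham_space_def ham_vector_fields_def ham_forms_def)

text \<open>Note that \<open>n - 1 + i\<close> is nonnegative in this range, so that no degree is truncated.\<close>

lemma Ham_space_neg:
  "1 - int n \<le> i \<Longrightarrow> i < 0 \<Longrightarrow> x \<in> L i \<longleftrightarrow> fst x = 0 \<and> snd x \<in> \<Omega> (nat (int n - 1 + i))"
  by (cases x) (auto simp: Ham_space_def)

lemma Ham_space_outside: "i \<notin> {1 - int n..0} \<Longrightarrow> L i = {0}"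
  using n by (auto simp: Ham_space_def)

lemma Ham_space_subspace: "subspace (L i)"
proof -
  consider "i = 0" | "1 - int n \<le> i" "i < 0" | "i \<notin> {1 - int n..0}" by fastforce
  then show ?thesis
  proof cases
    case 1
    show ?thesis
      unfolding 1 subspace_def
    proof (intro conjI ballI allI)
      show "0 \<in> L 0"
        by (simp add: zero_prod_def Ham_space_0 interior_zero_field[OF \<omega>])
    next
      fix x y assume "x \<in> L 0" "y \<in> L 0"
      then show "x + y \<in> L 0"
        by (cases x; cases y)
          (simp add: Ham_space_0 field_add form_add ext_deriv_add[where k = "n - 1" and l = "n - 1"]
            interior_field_add[OF \<omega>])
    next
      fix c x assume "x \<in> L 0"
      then show "c *\<^sub>R x \<in> L 0"
        by (cases x) (simp add: scaleR_Pair Ham_space_0 field_scaleR form_scaleR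
            ext_deriv_scaleR[where k = "n - 1"] interior_scaleR_field[OF \<omega>])
    qed
  next
    case 2
    then show ?thesis by (simp add: subspace_def Ham_space_neg form_add form_scaleR)
  next
    case 3
    then show ?thesis by (simp add: Ham_space_outside)
  qed
qed

lemma Ham_space_degree_nonzero: "x \<in> L p \<Longrightarrow> p \<noteq> 0 \<Longrightarrow> fst x = 0"
  by (auto simp: Ham_space_def split: if_splits)

lemma Ham_space_field: "x \<in> L p \<Longrightarrow> fst x \<in> V"
  by (cases "p = 0"; cases x) (auto simp: Ham_space_0 dest: Ham_space_degree_nonzero)

lemma Ham_space_form: "x \<in> L p \<Longrightarrow> \<exists>k. snd x \<in> \<Omega> k"
  by (auto simp: Ham_space_def ham_forms_def split: if_splits)

lemma homogeneous_fields: "homogeneous L xs \<Longrightarrow> set (fields xs) \<subseteq> V"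
  using Ham_space_field by (fastforce simp: homogeneous_def)

text \<open>Elements of nonzero degree have no vector field component. As \<open>homogeneous\<close> also admits the zero
vector in degrees where the space is trivial, arguments of total degree \<open>0\<close> need not all be of
degree \<open>0\<close>; their bracket vanishes for the present reason.\<close>

lemma zero_in_fields:
  "homogeneous L xs \<Longrightarrow> x \<in> set xs \<Longrightarrow> fst x \<noteq> 0 \<Longrightarrow> 0 \<in> set (fields xs)"
  using Ham_space_degree_nonzero[of "snd x" "fst x"] by (force simp: homogeneous_def)

lemma Ham_bracket_zero_field:
  assumes "homogeneous L xs" "length xs = k" "2 \<le> k" "0 \<in> set (fields xs)"
  shows "l k xs = 0"
  using multibracket_zero_entry[OF \<omega> homogeneous_fields[OF assms(1)] assms(4)] assms(2,3)
  by (simp add: Ham_bracket_eq_multibracket)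

lemma Ham_bracket_degree_nonzero:
  assumes "homogeneous L xs" "length xs = k" "2 \<le> k" "x \<in> set xs" "fst x \<noteq> 0"
  shows "l k xs = 0"
  using Ham_bracket_zero_field[OF assms(1-3)] zero_in_fields[OF assms(1,4,5)] .

lemma Ham_bracket_head_zero:
  assumes "homogeneous L zs" "Suc (length zs) = k"
  shows "l k ((p, 0) # zs) = 0"
proof (cases "k = 1")
  case True
  then show ?thesis using assms Ham_bracket_1[of M \<omega> p 0] by (auto simp: zero_prod_def)
next
  case False
  have "homogeneous L ((p, 0) # zs)"
    using assms(1) subspace_0[OF Ham_space_subspace] by (simp add: homogeneous_def)
  then show ?thesis
    using Ham_bracket_zero_field[of "(p, 0) # zs" k] False assms(2) by simp
qed

text \<open>For two vector fields this is \<open>d \<iota>(v \<and> w)\<omega> = -\<iota>\<^bsub>[v,w]\<^esub>\<omega>\<close>, the central formula for a list of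
length \<open>2\<close>. With more than \<open>n + 1\<close> vector fields the contraction vanishes, in accordance with the
target being trivial.\<close>

lemma multibracket_mem:
  assumes vs: "set vs \<subseteq> V" "\<And>v. v \<in> set vs \<Longrightarrow> d (interior v \<omega>) = 0" and len: "2 \<le> length vs"
  shows "multibracket \<omega> vs \<in> L (2 - int (length vs))"
proof -
  let ?k = "length vs"
  consider "?k = 2" | "2 < ?k" "?k \<le> n + 1" | "n + 1 < ?k" using len by linarith
  then show ?thesis
  proof cases
    case 1
    then obtain v w where vw: "vs = [v, w]"
      by (auto simp: numeral_2_eq_2 length_Suc_conv)
    have pairs: "{(i, j). i < j \<and> j < 2} = {(0, 1::nat)}" by auto
    have "d (contract [v, w] \<omega>) = - interior (lie_bracket v w) \<omega>"
      using ext_deriv_contract[OF \<omega> closed vs] by (simp add: vw pairs nths_remove nths_remove_two contract_Cons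
          flip: numeral_2_eq_2)
    moreover have "contract [v, w] \<omega> \<in> \<Omega> (n - 1)"
      using form_contract[OF \<omega>, of "[v, w]"] vs by (simp add: vw)
    moreover have "varsigma (Suc (Suc 0)) = 1" by (simp add: varsigma_def)
    ultimately show ?thesis
      using vs by (simp add: vw multibracket_def Ham_space_0 field_lie_bracket)
  next
    case 2
    have "nat (int n - 1 + (2 - int ?k)) = n + 1 - ?k" using 2 by linarith
    then show ?thesis
      using 2 form_contract[OF \<omega> vs(1)]
      by (simp add: Ham_space_neg multibracket_def form_scaleR)
  next
    case 3
    then show ?thesis
      using n subspace_0[OF Ham_space_subspace]
      by (simp add: multibracket_def contract_too_long[OF \<omega>] flip: zero_prod_def)
  qed
qed

text \<open>By \<open>d\<^sup>2 = 0\<close>, since \<open>\<iota>\<^bsub>v\<^esub>\<omega> = -d\<alpha>\<close>. This supplies the hypothesis of the central formula.\<close>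

lemma hamiltonian_closed:
  assumes "x \<in> L 0" shows "d (interior (fst x) \<omega>) = 0"
proof -
  obtain v \<alpha> where x: "x = (v, \<alpha>)" by (cases x)
  then have v: "v \<in> V" "\<alpha> \<in> \<Omega> (n - 1)" "d \<alpha> = - interior v \<omega>"
    using assms by (auto simp: Ham_space_0)
  have "d (- interior v \<omega>) = 0"
    using ext_deriv_ext_deriv[OF v(2)] v(3) by simp
  then show ?thesis
    using ext_deriv_uminus[OF form_interior[OF \<omega> v(1)]] by (simp add: x)
qed

text \<open>In degree \<open>-1\<close>, the value \<open>(0, d\<alpha>)\<close> of the unary bracket lies in the space of degree \<open>0\<close> since
\<open>d d \<alpha> = 0 = -\<iota>\<^sub>0\<omega>\<close>.\<close>

lemma Ham_bracket_mem:
  assumes "homogeneous L xs" "length xs = k" "1 \<le> k"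
  shows "l k xs \<in> L (degree_of xs + (2 - int k))"
proof (cases "k = 1")
  case True
  then obtain p x where xs: "xs = [(p, x)]" and x: "x \<in> L p"
    using assms by (cases xs) (auto simp: homogeneous_def)
  consider "1 - int n \<le> p" "p < 0" | "0 \<le> p" | "p < 0" "p \<notin> {1 - int n..0}" by fastforce
  then have "(if p < 0 then (0, d (snd x)) else 0) \<in> L (p + 1)"
  proof cases
    case 1
    then have x: "snd x \<in> \<Omega> (nat (int n - 1 + p))"
      using Ham_space_neg x by blast
    have dx: "d (snd x) \<in> \<Omega> (nat (int n - 1 + (p + 1)))"
      using form_ext_deriv[OF x] 1 by (simp add: Suc_nat_eq_nat_zadd1 algebra_simps)
    show ?thesis
    proof (cases "p = - 1")
      case True
      moreover have "nat (int n - 1) = n - 1" by linarith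
      ultimately show ?thesis
        using dx ext_deriv_ext_deriv[OF x]
        by (simp add: Ham_space_0 interior_zero_field[OF \<omega>])
    next
      case False
      then show ?thesis using 1 dx by (simp add: Ham_space_neg)
    qed
  next
    case 2
    then show ?thesis by (simp add: subspace_0 Ham_space_subspace)
  next
    case 3
    then have "x = 0" using x Ham_space_outside by blast
    then show ?thesis by (simp add: subspace_0 Ham_space_subspace flip: zero_prod_def)
  qed
  then show ?thesis unfolding True xs Ham_bracket_1 by (simp add: degree_of_def)
next
  case False
  then have k: "2 \<le> k" using assms by simp
  show ?thesis
  proof (cases "degree_of xs = 0 \<and> (\<forall>x\<in>set xs. fst x = 0)")
    case True
    have "set (fields xs) \<subseteq> V" by (rule homogeneous_fields[OF assms(1)])
    moreover have "d (interior v \<omega>) = 0" if "v \<in> set (fields xs)" for v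
      using that assms(1) True by (force simp: homogeneous_def intro: hamiltonian_closed)
    ultimately show ?thesis
      using multibracket_mem[of "fields xs"] True k assms(2) by (simp add: Ham_bracket_eq_multibracket)
  next
    case False
    then have "l k xs = 0"
      using Ham_bracket_degree_nonzero[OF assms(1,2) k] Ham_bracket_eq_multibracket[OF assms(2) k] by auto
    then show ?thesis by (simp add: subspace_0 Ham_space_subspace)
  qed
qed

lemma Ham_bracket_multilinear:
  assumes "1 \<le> k"
  shows "graded_multilinear L k (2 - int k) (l k)"
  unfolding graded_multilinear_def
proof (intro allI impI conjI ballI)
  fix xs assume xs: "length xs = k \<and> homogeneous L xs"
  then show "l k xs \<in> L (degree_of xs + (2 - int k))"
    using Ham_bracket_mem assms by blast
  fix i p u assume i: "i < k" and u: "u \<in> L p"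
  have fields_update: "fields (xs[i := (p, y)]) = (fields xs)[i := fst y]" for y
    by (simp add: map_update)
  note uV = Ham_space_field[OF u]
  have fV: "set (fields xs) \<subseteq> V" using homogeneous_fields xs by blast
  have singleton: "xs[i := (p, y)] = [(p, y)]" if "k = 1" for y
    using that xs i by (cases xs) auto
  obtain a where a: "snd u \<in> \<Omega> a" using Ham_space_form[OF u] by blast
  show "l k (xs[i := (p, c *\<^sub>R u)]) = c *\<^sub>R l k (xs[i := (p, u)])" for c
  proof (cases "k = 1")
    case True
    then show ?thesis
      unfolding singleton[OF True] unfolding True Ham_bracket_1
      by (simp add: ext_deriv_scaleR[OF a] scaleR_Pair)
  next
    case False
    then show ?thesis
      using assms xs i uV fV multibracket_update_scaleR[OF \<omega> fV, of i "fst u" c]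
      by (simp add: Ham_bracket_eq_multibracket fields_update degree_of_update)
  qed
  fix v assume v: "v \<in> L p"
  obtain b where b: "snd v \<in> \<Omega> b" using Ham_space_form[OF v] by blast
  show "l k (xs[i := (p, u + v)]) = l k (xs[i := (p, u)]) + l k (xs[i := (p, v)])"
  proof (cases "k = 1")
    case True
    then show ?thesis
      unfolding singleton[OF True] unfolding True Ham_bracket_1
      by (simp add: ext_deriv_add[OF a b])
  next
    case False
    then show ?thesis
      using assms xs i multibracket_update_add[OF \<omega> fV, of i "fst u" "fst v"] uV Ham_space_field[OF v]
      by (simp add: Ham_bracket_eq_multibracket fields_update degree_of_update)
  qed
qed

text \<open>If all degrees are \<open>0\<close> then there are no Koszul signs, and the form \<open>\<omega>\<close> is alternating. Otherwise
both sides vanish.\<close>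

lemma Ham_bracket_skew:
  assumes "1 \<le> k"
  shows "graded_skew L k (l k)"
  unfolding graded_skew_def
proof (intro allI impI)
  fix xs \<sigma> assume "length xs = k \<and> homogeneous L xs \<and> \<sigma> permutes {..<k}"
  then have xs: "length xs = k" "homogeneous L xs" and \<sigma>: "\<sigma> permutes {..<k}" by auto
  have set: "set (permute_list \<sigma> xs) = set xs"
    using \<sigma> xs by (simp add: set_permute_list)
  show "l k (permute_list \<sigma> xs) = of_int (sign \<sigma> * koszul_sign \<sigma> xs) *\<^sub>R l k xs"
  proof (cases "k = 1")
    case True
    then have "\<sigma> = id" using \<sigma> by (simp add: lessThan_Suc permutes_sing)
    then show ?thesis by (simp add: koszul_sign_id sign_id)
  next
    case False
    then have k: "2 \<le> k" using assms by simp
    show ?thesis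
    proof (cases "\<forall>x\<in>set xs. fst x = 0")
      case True
      have deg: "degree_of ys = 0" if "set ys = set xs" for ys :: "(int \<times> 'a vfield \<times> 'a form) list"
        using that True by (auto intro: degree_of_zero)
      have "multibracket \<omega> (permute_list \<sigma> (fields xs)) = of_int (sign \<sigma>) *\<^sub>R multibracket \<omega> (fields xs)"
        by (rule alternating_permute_list[of k]) (use xs \<sigma> multibracket_swap[OF \<omega>] in auto)
      moreover have "koszul_sign \<sigma> xs = 1"
        using True \<sigma> xs by (intro koszul_sign_even) auto
      ultimately show ?thesis
        using xs k \<sigma> by (simp add: Ham_bracket_eq_multibracket deg set permute_list_map)
    next
      case False
      then obtain x where x: "x \<in> set xs" "fst x \<noteq> 0" by blast
      have "homogeneous L (permute_list \<sigma> xs)"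
        using xs(2) by (simp add: homogeneous_def set)
      then have "l k (permute_list \<sigma> xs) = 0"
        using x k xs by (intro Ham_bracket_degree_nonzero[of _ k x]) (simp_all add: set)
      moreover have "l k xs = 0"
        using x k xs by (intro Ham_bracket_degree_nonzero[of _ k x])
      ultimately show ?thesis by simp
    qed
  qed
qed

text \<open>A bracket of at least two arguments vanishes if one of them has no vector field component. The
value of a unary inner bracket is of this kind, and so is every argument of nonzero degree. An
inner bracket of at least three arguments of degree \<open>0\<close> has negative degree, so it annihilates
an outer bracket that has further arguments. Finally, two arguments of degree \<open>0\<close> have a bracket
of degree \<open>0\<close>, where the unary bracket vanishes.\<close>

lemma Ham_bracket_composite_zero:
  assumes hom: "homogeneous L (ys @ zs)" and len: "length ys = i" "Suc (length zs) = j"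
    and ij: "1 \<le> i" "3 \<le> i + j"
    and cases: "i = 1 \<or> (\<exists>x\<in>set (ys @ zs). fst x \<noteq> 0) \<or> 3 \<le> i \<and> 2 \<le> j \<or> i = 2 \<and> j = 1"
  shows "l j ((degree_of ys + 2 - int i, l i ys) # zs) = 0" (is "l j (?y # zs) = 0")
proof -
  have ys: "homogeneous L ys" and zs: "homogeneous L zs"
    using hom by (auto simp: homogeneous_def)
  have y: "homogeneous L (?y # zs)"
    using Ham_bracket_mem[OF ys len(1) ij(1)] zs by (simp add: homogeneous_def add_diff_eq)
  show ?thesis
  proof (cases "i = 1")
    case True
    then obtain p x where "ys = [(p, x)]" using len by (cases ys) auto
    then have "fst (l i ys) = 0"
      unfolding \<open>i = 1\<close> by (simp add: Ham_bracket_1[unfolded One_nat_def])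
    then show ?thesis
      using ij len True y by (intro Ham_bracket_zero_field) auto
  next
    case False
    then have i: "2 \<le> i" using ij by simp
    show ?thesis
    proof (cases "\<exists>x\<in>set ys. fst x \<noteq> 0")
      case True
      then have "l i ys = 0"
        using Ham_bracket_degree_nonzero[OF ys len(1) i] by blast
      then show ?thesis using Ham_bracket_head_zero[OF zs len(2)] by simp
    next
      case False
      then have deg: "degree_of ys = 0"
        using degree_of_zero by blast
      show ?thesis
      proof (cases "j = 1")
        case True
        then have "zs = []" using len by simp
        then have "i = 2" using cases False True \<open>i \<noteq> 1\<close> by auto
        then show ?thesis
          unfolding True \<open>zs = []\<close> Ham_bracket_1 by (simp add: deg)
      next
        case jn1: False
        then have j: "2 \<le> j" using len by simp
        have "\<exists>x\<in>set (?y # zs). fst x \<noteq> 0"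
          using cases False \<open>i \<noteq> 1\<close> jn1 by (auto simp: deg)
        then obtain x where "x \<in> set (?y # zs)" "fst x \<noteq> 0" by blast
        then show ?thesis
          using Ham_bracket_degree_nonzero[OF y _ j] len by simp
      qed
    qed
  qed
qed

text \<open>The sign \<open>(-1)\<^bsup>i + j + 1\<^esup>\<close> is the one of the shuffle that moves the entries \<open>i\<close> and \<open>j\<close> to the front.\<close>

lemma Ham_bracket_jacobi_fields:
  assumes vs: "set vs \<subseteq> V" "\<And>v. v \<in> set vs \<Longrightarrow> d (interior v \<omega>) = 0" and len: "3 \<le> length vs"
  shows "(\<Sum>(i, j)\<in>{(i, j). i < j \<and> j < length vs}. (-1) ^ Suc (i + j) *\<^sub>R
      multibracket \<omega> (lie_bracket (vs ! i) (vs ! j) # nths vs (- {i, j}))) +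
    (0, d (snd (multibracket \<omega> vs))) = 0" (is "sum ?f ?P + _ = 0")
proof (rule prod_eqI)
  obtain m where m: "length vs = Suc m" using len by (cases "length vs") auto
  have lens: "length (nths vs (- {i, j})) = m - 1" if "i < j" "j < Suc m" for i j
    using that m by (simp add: nths_remove_two nths_remove)
  show "fst (sum ?f ?P + (0, d (snd (multibracket \<omega> vs)))) = fst 0"
  proof (cases "length vs = 3")
    case True
    then obtain u v w where uvw: "vs = [u, v, w]"
      by (auto simp: numeral_3_eq_3 length_Suc_conv)
    have P: "?P = {(0, 1), (0, 2), (1, 2)}"
      using True by auto
    show ?thesis
      unfolding P using vs(1) lie_bracket_jacobi[of u v w]
      by (simp add: uvw multibracket_def nths_remove_two nths_remove lie_bracket_antisym[of "lie_bracket v w" u]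
        lie_bracket_antisym[of "lie_bracket u w" v])
  next
    case False
    have "fst (?f p) = 0" if "p \<in> ?P" for p
      using that False lens m len by (auto simp: multibracket_def)
    then show ?thesis by (simp add: fst_sum)
  qed
  let ?C = "\<lambda>i j. contract (lie_bracket (vs ! i) (vs ! j) # nths vs (- {i, j})) \<omega>"
  let ?S = "\<Sum>(i, j)\<in>?P. (-1) ^ (i + j) *\<^sub>R ?C i j"
  have "snd (sum ?f ?P) = (\<Sum>(i, j)\<in>?P. - varsigma m *\<^sub>R ((-1) ^ (i + j) *\<^sub>R ?C i j))"
    unfolding snd_sum using len m
    by (intro sum.cong refl) (auto simp: multibracket_def lens)
  also have "\<dots> = - varsigma m *\<^sub>R ?S"
    by (simp add: scaleR_sum_right split_def)
  finally have 1: "snd (sum ?f ?P) = - varsigma m *\<^sub>R ?S" .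
  have "d (snd (multibracket \<omega> vs)) = varsigma (Suc m) *\<^sub>R d (contract vs \<omega>)"
    by (simp add: multibracket_def m ext_deriv_scaleR[OF form_contract[OF \<omega> vs(1)]])
  also have "d (contract vs \<omega>) = (-1) ^ Suc m *\<^sub>R ?S"
    using ext_deriv_contract[OF \<omega> closed vs] by (simp only: m)
  finally have 2: "d (snd (multibracket \<omega> vs)) = varsigma m *\<^sub>R ?S"
    unfolding varsigma_Suc[of m] by (simp add: mult.commute)
  show "snd (sum ?f ?P + (0, d (snd (multibracket \<omega> vs)))) = snd 0"
    unfolding snd_add 1 snd_conv 2 by simp
qed

text \<open>Only the terms with \<open>i = 2\<close> and \<open>i = m\<close> can be nonzero, and they are evaluated by means of the
preceding lemma.\<close>

lemma Ham_bracket_jacobi: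
  assumes hom: "homogeneous L xs" and m: "1 \<le> length xs"
  shows "jacobiator l xs = 0"
proof -
  define m where "m = length xs"
  define T where "T = (\<lambda>i j \<sigma>. of_int (sign \<sigma> * koszul_sign \<sigma> xs * (-1) ^ (i * (j - 1))) *\<^sub>R
    l j ((degree_of (take i (permute_list \<sigma> xs)) + 2 - int i, l i (take i (permute_list \<sigma> xs))) #
      drop i (permute_list \<sigma> xs)))"
  let ?S = "{(i, j). 1 \<le> i \<and> 1 \<le> j \<and> i + j = m + 1}"
  have jac: "jacobiator l xs = (\<Sum>(i, j)\<in>?S. sum (T i j) (shuffles_of i m))"
    by (simp add: jacobiator_def Let_def T_def m_def)
  have hom_perm: "homogeneous L (permute_list \<sigma> xs)" and set_perm: "set (permute_list \<sigma> xs) = set xs"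
    if "\<sigma> \<in> shuffles_of i m" for \<sigma> i
  proof -
    show "set (permute_list \<sigma> xs) = set xs"
      using that by (intro set_permute_list) (auto simp: shuffles_of_def m_def)
    then show "homogeneous L (permute_list \<sigma> xs)"
      using hom by (simp add: homogeneous_def)
  qed
  have T_zero: "T i j \<sigma> = 0"
    if \<sigma>: "\<sigma> \<in> shuffles_of i m" and ij: "1 \<le> i" "1 \<le> j" "i + j = m + 1" "2 \<le> m"
      and cases: "i = 1 \<or> (\<exists>x\<in>set xs. fst x \<noteq> 0) \<or> 3 \<le> i \<and> 2 \<le> j \<or> i = 2 \<and> j = 1" for i j \<sigma>
  proof -
    let ?ys = "take i (permute_list \<sigma> xs)" and ?zs = "drop i (permute_list \<sigma> xs)"
    have "l j ((degree_of ?ys + 2 - int i, l i ?ys) # ?zs) = 0"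
    proof (rule Ham_bracket_composite_zero)
      show "length ?ys = i" "Suc (length ?zs) = j" using ij by (simp_all add: m_def)
    qed (use hom_perm[OF \<sigma>] set_perm[OF \<sigma>] ij cases in auto)
    then show ?thesis by (simp add: T_def)
  qed
  consider "m = 1" | "2 \<le> m" "m = 2 \<or> (\<exists>x\<in>set xs. fst x \<noteq> 0)"
    | "3 \<le> m" "\<forall>x\<in>set xs. fst x = 0"
    using assms(2) unfolding m_def by fastforce
  then show ?thesis
  proof cases
    case 1
    then obtain p x where xs: "xs = [(p, x)]"
      unfolding m_def by (cases xs) auto
    have "x \<in> L p" using hom by (simp add: xs homogeneous_def)
    then obtain k where "snd x \<in> \<Omega> k" using Ham_space_form by blast
    then have "l 1 [(1 + p, l 1 [(p, x)])] = 0"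
      using ext_deriv_ext_deriv[of "snd x" k]
      unfolding Ham_bracket_1 by (simp flip: zero_prod_def)
    moreover have S: "?S = {(1, 1)}" using 1 by auto
    ultimately show ?thesis
      unfolding jac S 1 by (simp add: shuffles_of_all[of 1, simplified] T_def xs degree_of_def)
  next
    case 2
    have "sum (T i j) (shuffles_of i m) = 0" if "(i, j) \<in> ?S" for i j
      using that 2 by (intro sum.neutral ballI T_zero) auto
    then show ?thesis unfolding jac by (intro sum.neutral) auto
  next
    case 3
    have deg: "degree_of ys = 0" if "set ys \<subseteq> set xs" for ys :: "(int \<times> 'a vfield \<times> 'a form) list"
      using that 3(2) by (intro degree_of_zero) auto
    have m2: "2 \<le> m" using 3 by simp
    let ?vs = "fields xs"
    have len: "length ?vs = m" by (simp add: m_def)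
    have vs: "set ?vs \<subseteq> V" by (rule homogeneous_fields[OF hom])
    have ham: "d (interior v \<omega>) = 0" if "v \<in> set ?vs" for v
      using that hom 3(2) by (force simp: homogeneous_def intro: hamiltonian_closed)
    have koszul: "koszul_sign \<sigma> xs = 1" if "\<sigma> \<in> shuffles_of i m" for \<sigma> i
      using that 3(2) by (intro koszul_sign_even) (auto simp: shuffles_of_def m_def)
    have "jacobiator l xs = (\<Sum>(i, j)\<in>{(2, m - 1), (m, 1)}. sum (T i j) (shuffles_of i m))"
      unfolding jac
    proof (rule sum.mono_neutral_right)
      show "finite ?S"
        by (rule finite_subset[of _ "{..m} \<times> {..m}"]) auto
      show "{(2, m - 1), (m, 1)} \<subseteq> ?S" using 3 by auto
      show "\<forall>p\<in>?S - {(2, m - 1), (m, 1)}. (case p of (i, j) \<Rightarrow> sum (T i j) (shuffles_of i m)) = 0"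
      proof
        fix p assume p: "p \<in> ?S - {(2, m - 1), (m, 1)}"
        obtain i j where ij: "p = (i, j)" by (cases p)
        have "sum (T i j) (shuffles_of i m) = 0"
          using p 3 unfolding ij by (intro sum.neutral ballI T_zero) auto
        then show "(case p of (i, j) \<Rightarrow> sum (T i j) (shuffles_of i m)) = 0"
          by (simp add: ij)
      qed
    qed
    also have "\<dots> = sum (T 2 (m - 1)) (shuffles_of 2 m) + sum (T m 1) (shuffles_of m m)"
      using 3 by simp
    also have "sum (T 2 (m - 1)) (shuffles_of 2 m) =
        (\<Sum>(i, j)\<in>{(i, j). i < j \<and> j < m}. T 2 (m - 1) (pair_shuffle i j))"
      unfolding shuffles_of_2[OF m2] sum.reindex[OF inj_on_pair_shuffle] by (rule sum.cong) auto
    also have "\<dots> = (\<Sum>(i, j)\<in>{(i, j). i < j \<and> j < m}. (-1) ^ Suc (i + j) *\<^sub>R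
        multibracket \<omega> (lie_bracket (?vs ! i) (?vs ! j) # nths ?vs (- {i, j})))"
    proof (intro sum.cong refl, safe)
      fix i j assume ij: "i < j" "j < m"
      let ?zs = "nths xs (- {i, j})"
      have \<sigma>: "pair_shuffle i j \<in> shuffles_of 2 m"
        unfolding shuffles_of_2[OF m2] by (rule image_eqI[of _ _ "(i, j)"]) (use ij in auto)
      have perm: "permute_list (pair_shuffle i j) xs = xs ! i # xs ! j # ?zs"
        using ij by (intro permute_list_pair_shuffle) (auto simp: m_def)
      have "length (xs ! i # xs ! j # ?zs) = m"
        unfolding perm[symmetric] by (simp add: m_def)
      then have zs: "Suc (length ?zs) = m - 1" by simp
      have sub: "set [xs ! i, xs ! j] \<subseteq> set xs" "set ?zs \<subseteq> set xs"
        using ij by (auto simp: m_def dest: in_set_nthsD)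
      have two: "l 2 [xs ! i, xs ! j] = multibracket \<omega> [?vs ! i, ?vs ! j]"
        using ij deg[OF sub(1)] by (simp add: Ham_bracket_eq_multibracket m_def)
      have "l (m - 1) ((0, l 2 [xs ! i, xs ! j]) # ?zs) =
          multibracket \<omega> (lie_bracket (?vs ! i) (?vs ! j) # nths ?vs (- {i, j}))"
        using 3 zs deg[OF sub(2)]
        by (simp add: Ham_bracket_eq_multibracket two degree_of_def multibracket_def[of _ "[_, _]"] nths_map)
      then show "T 2 (m - 1) (pair_shuffle i j) = (-1) ^ Suc (i + j) *\<^sub>R
          multibracket \<omega> (lie_bracket (?vs ! i) (?vs ! j) # nths ?vs (- {i, j}))"
        using deg[OF sub(1)] by (simp add: T_def perm koszul[OF \<sigma>] sign_pair_shuffle)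
    qed
    also have "sum (T m 1) (shuffles_of m m) = (0, d (snd (multibracket \<omega> ?vs)))"
    proof -
      have "l 1 [(2 - int m, l m xs)] = (0, d (snd (multibracket \<omega> ?vs)))"
        unfolding Ham_bracket_1 using 3 deg[OF order_refl]
        by (simp add: Ham_bracket_eq_multibracket m_def)
      then show ?thesis
        using koszul[of id m] deg[OF order_refl]
        by (simp add: shuffles_of_all T_def sign_id m_def)
    qed
    also have "(\<Sum>(i, j)\<in>{(i, j). i < j \<and> j < m}. (-1) ^ Suc (i + j) *\<^sub>R
        multibracket \<omega> (lie_bracket (?vs ! i) (?vs ! j) # nths ?vs (- {i, j}))) + \<dots> = 0"
      using Ham_bracket_jacobi_fields[OF vs ham] 3 by (simp only: len)
    finally show ?thesis .
  qed
qed

end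

theorem theorem4p7:
  fixes n :: nat
    and M :: "('a, 'b::real_normed_vector) atlas_space"
    and \<omega> :: "'a form"
  assumes "n \<ge> 1"
    and "pre_n_plectic n M \<omega>"
  shows "Lie_n_algebra n (Ham_space n M \<omega>) (Ham_bracket M \<omega>)"
proof -
  interpret pre_n_plectic_manifold M n \<omega>
    using assms by unfold_locales (auto simp: pre_n_plectic_def)
  show ?thesis
    unfolding Lie_n_algebra_def L_infinity_algebra_def
    using Ham_space_subspace Ham_bracket_multilinear Ham_bracket_skew Ham_bracket_jacobi
      Ham_space_outside by blast
qed

end
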